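(* For every $\alpha\in(0,1)$, the family of processes $X_n^{(\alpha)}$, $n\in\mathbb{N}$, given by the rescaled linear interpolations of the $\alpha$-skew random walk on $\mathbb{Z}$, is tight in $C(\mathbb{R}_+,\mathbb{R})$ (that is, the family of their laws on $C(\mathbb{R}_+,\mathbb{R})$ is tight).
   Context: Let $\mathbb{N}=\{1,2,\dots\}$ and $\mathbb{R}_+=[0,\infty)$. $C(\mathbb{R}_+,\mathbb{R})$ is the space of continuous functions from $\mathbb{R}_+$ into $\mathbb{R}$, equipped with the topology of uniform convergence on compact sets. For $\alpha\in(0,1)$, the $\alpha$-skew random walk on $\mathbb{Z}$ starting at $0$ is the (time-homogeneous) birth-death Markov chain $S^{(\alpha)}=\{S_k^{(\alpha)}: k\ge 0\}$ on $\mathbb{Z}$ with $S_0^{(\alpha)}=0$ and one-step transition probabilities $$P\bigl(S_{k+1}^{(\alpha)}=m+1\mid S_k^{(\alpha)}=m\bigr)=\begin{cases}\alpha & \text{if } m=0\\ \tfrac12 & \text{otherwise,}\end{cases}\qquad P\bigl(S_{k+1}^{(\alpha)}=m-1\mid S_k^{(\alpha)}=m\bigr)=\begin{cases}1-\alpha & \text{if } m=0\\ \tfrac12 & \text{otherwise.}\end{cases}$$ For $n\in\mathbb{N}$ and $t\ge 0$, with $[x]$ denoting the integer part of a real number $x$, $$X_n^{(\alpha)}(t)=\frac{1}{\sqrt n}\Bigl(S^{(\alpha)}_{[nt]}+(nt-[nt])\bigl(S^{(\alpha)}_{[nt]+1}-S^{(\alpha)}_{[nt]}\bigr)\Bigr).$$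 *)

theory Defs
  imports "HOL-Probability.Probability"
begin

text \<open>Points of the space are continuous functions on \<open>{0..}\<close>; extensionality makes two of them
  equal as soon as they agree on \<open>{0..}\<close>.\<close>

typedef cpath = "{f :: real \<Rightarrow> real. continuous_on {0..} f \<and> f \<in> extensional {0..}}"
  morphisms cpath_apply Abs_cpath
proof
  have "continuous_on {0..} (restrict (\<lambda>_. 0 :: real) {0 :: real..})"
    by (rule continuous_on_eq[OF continuous_on_const]) simp
  then show "restrict (\<lambda>_. 0) {0..} \<in> {f :: real \<Rightarrow> real. continuous_on {0..} f \<and> f \<in> extensional {0..}}"
    by simp
qed

setup_lifting type_definition_cpath

instantiation cpath :: topological_space
begin

text \<open>Topology of uniform convergence on compact sets: the basic neighbourhoods of a path \<open>f\<close> are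
  the sets of paths that are uniformly \<open>e\<close>-close to \<open>f\<close> on a compact subset of the half-line.\<close>

definition open_cpath :: "cpath set \<Rightarrow> bool" where
  "open_cpath U \<longleftrightarrow>
     (\<forall>f\<in>U. \<exists>K e. compact K \<and> K \<subseteq> {0..} \<and> 0 < e \<and>
        {g. \<forall>t\<in>K. \<bar>cpath_apply g t - cpath_apply f t\<bar> < e} \<subseteq> U)"

instance
proof
  show "open (UNIV :: cpath set)"
    unfolding open_cpath_def by (intro ballI exI[of _ "{}"] exI[of _ "1::real"]) simp
next
  fix S T :: "cpath set"
  assume S: "open S" and T: "open T"
  show "open (S \<inter> T)"
    unfolding open_cpath_def
  proof
    fix f assume f: "f \<in> S \<inter> T"
    obtain K e where 1: "compact K" "K \<subseteq> {0..}" "0 < e"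
      "{g. \<forall>t\<in>K. \<bar>cpath_apply g t - cpath_apply f t\<bar> < e} \<subseteq> S"
      using bspec[OF S[unfolded open_cpath_def], of f] f by auto
    obtain L d where 2: "compact L" "L \<subseteq> {0..}" "0 < d"
      "{g. \<forall>t\<in>L. \<bar>cpath_apply g t - cpath_apply f t\<bar> < d} \<subseteq> T"
      using bspec[OF T[unfolded open_cpath_def], of f] f by auto
    have "compact (K \<union> L) \<and> K \<union> L \<subseteq> {0..} \<and> 0 < min e d \<and>
        {g. \<forall>t\<in>K \<union> L. \<bar>cpath_apply g t - cpath_apply f t\<bar> < min e d} \<subseteq> S \<inter> T"
      using 1 2 by (intro conjI compact_Un Int_greatest; (simp; fail)?; fastforce)
    then show "\<exists>K e. compact K \<and> K \<subseteq> {0..} \<and> 0 < e \<and>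
        {g. \<forall>t\<in>K. \<bar>cpath_apply g t - cpath_apply f t\<bar> < e} \<subseteq> S \<inter> T"
      by (intro exI)
  qed
next
  fix \<U> :: "cpath set set"
  assume *: "\<forall>U\<in>\<U>. open U"
  show "open (\<Union>\<U>)"
    unfolding open_cpath_def
  proof
    fix f assume "f \<in> \<Union>\<U>"
    then obtain U where U: "U \<in> \<U>" "f \<in> U" by blast
    have "open U" using * U by simp
    then obtain K e where Ke: "compact K" "K \<subseteq> {0..}" "0 < e"
      "{g. \<forall>t\<in>K. \<bar>cpath_apply g t - cpath_apply f t\<bar> < e} \<subseteq> U"
      using U unfolding open_cpath_def by (auto dest: bspec[of U _ f])
    have "U \<subseteq> \<Union>\<U>" using U by (simp add: Union_upper)
    with Ke show "\<exists>K e. compact K \<and> K \<subseteq> {0..} \<and> 0 < e \<and>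
        {g. \<forall>t\<in>K. \<bar>cpath_apply g t - cpath_apply f t\<bar> < e} \<subseteq> \<Union>\<U>"
      by (intro exI[of _ K] exI[of _ e]) (meson order_trans)
  qed
qed

end

text \<open>Requiring each member to be a Borel probability measure excludes degenerate values of
  \<^const>\<open>distr\<close> (which is a null measure at non-measurable maps).\<close>

definition tight_family :: "'a::topological_space measure set \<Rightarrow> bool" where
  "tight_family \<M> \<longleftrightarrow>
     (\<forall>\<mu>\<in>\<M>. prob_space \<mu> \<and> sets \<mu> = sets borel) \<and>
     (\<forall>\<epsilon>>0. \<exists>K. compact K \<and> (\<forall>\<mu>\<in>\<M>. measure \<mu> K \<ge> 1 - \<epsilon>))"

text \<open>Time-homogeneous Markov chain on a countable state space with transition probabilities
  \<open>p x y\<close>: the conditional law of the next state, given any history of positive probability,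
  depends on the current state only and is given by \<open>p\<close>.\<close>

definition markov_chain ::
    "'a measure \<Rightarrow> (nat \<Rightarrow> 'a \<Rightarrow> 's::countable) \<Rightarrow> ('s \<Rightarrow> 's \<Rightarrow> real) \<Rightarrow> bool" where
  "markov_chain M S p \<longleftrightarrow>
     prob_space M \<and>
     (\<forall>k. S k \<in> measurable M (count_space UNIV)) \<and>
     (\<forall>k x y. measure M {\<omega> \<in> space M. \<forall>i\<le>k. S i \<omega> = x i} > 0 \<longrightarrow>
        \<P>(\<omega> in M. S (Suc k) \<omega> = y \<bar> \<forall>i\<le>k. S i \<omega> = x i) = p (x k) y)"

definition skew_transition :: "real \<Rightarrow> int \<Rightarrow> int \<Rightarrow> real" where
  "skew_transition \<alpha> m m' =
     (if m' = m + 1 then (if m = 0 then \<alpha> else 1/2)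
      else if m' = m - 1 then (if m = 0 then 1 - \<alpha> else 1/2)
      else 0)"

definition skew_random_walk :: "real \<Rightarrow> 'a measure \<Rightarrow> (nat \<Rightarrow> 'a \<Rightarrow> int) \<Rightarrow> bool" where
  "skew_random_walk \<alpha> M S \<longleftrightarrow>
     markov_chain M S (skew_transition \<alpha>) \<and> (AE \<omega> in M. S 0 \<omega> = 0)"

definition linear_interp :: "(nat \<Rightarrow> int) \<Rightarrow> real \<Rightarrow> real" where
  "linear_interp s u =
     real_of_int (s (nat \<lfloor>u\<rfloor>)) +
       (u - real_of_int \<lfloor>u\<rfloor>) * real_of_int (s (nat \<lfloor>u\<rfloor> + 1) - s (nat \<lfloor>u\<rfloor>))"

lemma linear_interp_eq_sum:
  assumes "0 \<le> u" "u < real N"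
  shows "linear_interp s u =
    real_of_int (s 0) + (\<Sum>k<N. max 0 (min 1 (u - real k)) * real_of_int (s (Suc k) - s k))"
proof -
  define j where "j = nat \<lfloor>u\<rfloor>"
  have j: "real j \<le> u" "u < real j + 1" "real_of_int \<lfloor>u\<rfloor> = real j"
    using assms unfolding j_def by linarith+
  have "j < N" using j assms by linarith
  let ?g = "\<lambda>k. max 0 (min 1 (u - real k)) * real_of_int (s (Suc k) - s k)"
  have "sum ?g {..<N} = sum ?g {..<j} + (?g j + sum ?g {j<..<N})"
  proof -
    have "sum ?g {..<N} = sum ?g {..<j} + sum ?g {j..<N}"
      using \<open>j < N\<close> by (simp add: sum.atLeastLessThan_concat lessThan_atLeast0)
    also have "sum ?g {j..<N} = ?g j + sum ?g {j<..<N}"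
      using \<open>j < N\<close>
      by (simp only: sum.atLeast_Suc_lessThan atLeastSucLessThan_greaterThanLessThan)
    finally show ?thesis .
  qed
  also have "sum ?g {..<j} = (\<Sum>k<j. real_of_int (s (Suc k)) - real_of_int (s k))"
    using j by (intro sum.cong) auto
  also have "\<dots> = real_of_int (s j) - real_of_int (s 0)" by (rule sum_lessThan_telescope)
  also have "sum ?g {j<..<N} = 0"
    using j by (intro sum.neutral) auto
  also have "?g j = (u - real j) * real_of_int (s (Suc j) - s j)" using j by simp
  finally show ?thesis
    using j unfolding linear_interp_def j_def[symmetric] by simp
qed

lemma continuous_on_linear_interp: "continuous_on {0..} (linear_interp s)"
  unfolding continuous_on_eq_continuous_within
proof
  fix u :: real assume u: "u \<in> {0..}"
  obtain N where N: "u < real N" using reals_Archimedean2 by blast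
  let ?g = "\<lambda>u. real_of_int (s 0) + (\<Sum>k<N. max 0 (min 1 (u - real k)) * real_of_int (s (Suc k) - s k))"
  have "continuous_on {0..} ?g" by (intro continuous_intros)
  then have "continuous (at u within {0..}) ?g"
    using u by (simp add: continuous_on_eq_continuous_within)
  then show "continuous (at u within {0..}) (linear_interp s)"
  proof (rule continuous_transform_within)
    show "0 < real N - u" using N by simp
    fix v assume "v \<in> {0..}" "dist v u < real N - u"
    then show "?g v = linear_interp s v"
      by (subst linear_interp_eq_sum[of v N]) (auto simp: dist_real_def)
  qed (use u in simp)
qed

lift_definition rescaled_path :: "nat \<Rightarrow> (nat \<Rightarrow> int) \<Rightarrow> cpath"
  is "\<lambda>n s. restrict (\<lambda>t. linear_interp s (real n * t) / sqrt (real n)) {0..}"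
proof -
  fix n :: nat and s :: "nat \<Rightarrow> int"
  have "continuous_on {0..} (\<lambda>t. linear_interp s (real n * t) / sqrt (real n))"
    unfolding divide_inverse
    by (intro continuous_on_mult_right continuous_on_compose2[OF continuous_on_linear_interp]
          continuous_on_mult_left continuous_on_id) auto
  then have "continuous_on {0..} (restrict (\<lambda>t. linear_interp s (real n * t) / sqrt (real n)) {0..})"
    by (rule continuous_on_eq) simp
  then show "continuous_on {0..} (restrict (\<lambda>t. linear_interp s (real n * t) / sqrt (real n)) {0..}) \<and>
      restrict (\<lambda>t. linear_interp s (real n * t) / sqrt (real n)) {0..} \<in> extensional {0..}"
    by simp
qed

definition skew_process :: "(nat \<Rightarrow> 'a \<Rightarrow> int) \<Rightarrow> nat \<Rightarrow> 'a \<Rightarrow> cpath" where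
  "skew_process S n \<omega> = rescaled_path n (\<lambda>k. S k \<omega>)"

end

theory Submission
  imports Defs
begin

text \<open>
  Tightness follows from Kolmogorov's criterion: \<open>X n\<close> starts at 0, and
  \<open>E \<bar>X n t - X n s\<bar>\<^sup>4 \<le> C (t - s)\<^sup>2\<close> for a constant \<open>C\<close> that depends on \<open>\<alpha>\<close> only.

  The walk itself is not a martingale, since for \<open>\<alpha> \<noteq> 1/2\<close> it has a drift at each visit to the origin, but its
  image under the scale function \<open>skew_scale \<alpha>\<close>, which has slope \<open>1 - \<alpha>\<close> on the positive and
  \<open>\<alpha>\<close> on the negative half-line, is one, and its increments are bounded by 1. A
  recursion on the second and fourth conditional moments (\<open>skew_transition_moments\<close>) bounds the
  fourth moment of an increment over \<open>k\<close> steps by \<open>4 k\<^sup>2\<close>. The scale function is bi-Lipschitz, so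
  the same order of growth holds for the walk; the interpolation adds an error of at most one unit at
  each end, which is harmless over times of length at least 1, and over shorter times it is
  1-Lipschitz. Diffusive rescaling keeps the constant.

  On the topological side, \<open>dyadic_holder_paths J\<close> collects the paths from 0 whose increments between
  neighbouring dyadic points of level \<open>j \<ge> J\<close> are at most \<open>(9/10) ^ j\<close>, on a window \<open>[0, j]\<close>
  that grows with the level. Chaining turns this into a common modulus of continuity on every compact
  interval, hence these sets are compact by Arzela-Ascoli. By Markov's inequality a rescaled walk
  violates the condition at level \<open>j\<close> with probability at most
  \<open>j 2 ^ j \<cdot> C 4 ^ (- j) / (9/10) ^ (4 j)\<close>, which is summable because \<open>2 (9/10)\<^sup>4 > 1\<close>. The tail
  of the series is therefore small for large \<open>J\<close>, uniformly in \<open>n\<close>.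
\<close>

section \<open>Compactness in the space of continuous paths\<close>

lemma continuous_on_cpath_apply:
  assumes "0 \<le> t"
  shows "continuous_on UNIV (\<lambda>f. cpath_apply f t)"
  unfolding continuous_on_open_vimage[OF open_UNIV]
proof (intro allI impI)
  fix B :: "real set" assume B: "open B"
  show "open ((\<lambda>f. cpath_apply f t) -` B \<inter> UNIV)"
    unfolding open_cpath_def
  proof
    fix f assume "f \<in> (\<lambda>f. cpath_apply f t) -` B \<inter> UNIV"
    then obtain e where "e > 0" "\<And>y. dist y (cpath_apply f t) < e \<Longrightarrow> y \<in> B"
      using B unfolding open_dist by auto
    then show "\<exists>K e. compact K \<and> K \<subseteq> {0..} \<and> 0 < e \<and>
        {g. \<forall>t\<in>K. \<bar>cpath_apply g t - cpath_apply f t\<bar> < e} \<subseteq> (\<lambda>f. cpath_apply f t) -` B \<inter> UNIV"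
      using assms by (intro exI[of _ "{t}"] exI[of _ e]) (auto simp: dist_real_def)
  qed
qed

text \<open>Telescoping over \<open>N\<close> steps. On an equicontinuous set of functions that vanish at 0 one \<open>N\<close>
  works for all of them, so this yields pointwise boundedness.\<close>

lemma bounded_by_steps:
  fixes f :: "real \<Rightarrow> real"
  assumes "f 0 = 0" "0 \<le> t"
    and step: "\<And>u v. \<lbrakk>u \<in> {0..t}; v \<in> {0..t}; \<bar>u - v\<bar> \<le> t / real N\<rbrakk> \<Longrightarrow> \<bar>f u - f v\<bar> \<le> 1"
    and "0 < N"
  shows "\<bar>f t\<bar> \<le> real N"
proof -
  have "\<bar>f (t * (real i / real N))\<bar> \<le> real i" if "i \<le> N" for i
    using that
  proof (induction i)
    case 0
    then show ?case using assms by simp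
  next
    case (Suc i)
    have "t * (real j / real N) \<in> {0..t}" if "j \<le> N" for j
      using that assms mult_left_mono[of "real j / real N" 1 t] by simp
    from this[of i] this[of "Suc i"] Suc.prems
    have "t * (real i / real N) \<in> {0..t}" "t * (real (Suc i) / real N) \<in> {0..t}" by simp_all
    moreover have "\<bar>t * (real (Suc i) / real N) - t * (real i / real N)\<bar> \<le> t / real N"
      using assms by (simp add: field_simps)
    ultimately have "\<bar>f (t * (real (Suc i) / real N)) - f (t * (real i / real N))\<bar> \<le> 1"
      by (intro step)
    then show ?case using Suc.IH Suc.prems by linarith
  qed
  from this[of N] show ?thesis using assms by simp
qed

text \<open>The topology on functions is that of pointwise convergence, in which a box of compact intervals is
  compact by Tychonoff's theorem.\<close>

lemma compact_pointwise_closed: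
  fixes B :: "real \<Rightarrow> real"
  assumes "closed G" "G \<subseteq> (\<Pi>\<^sub>E t\<in>UNIV. {- B t .. B t})"
  shows "compact (G :: (real \<Rightarrow> real) set)"
proof -
  have "compactin (product_topology (\<lambda>_. euclidean) UNIV) (\<Pi>\<^sub>E t\<in>UNIV. {- B t .. B t})"
    by (simp add: compactin_PiE)
  then have "compact (\<Pi>\<^sub>E t\<in>UNIV. {- B t .. B t})"
    by (simp only: euclidean_product_topology compactin_euclidean_iff)
  then have "compact ((\<Pi>\<^sub>E t\<in>UNIV. {- B t .. B t}) \<inter> G)"
    using assms(1) by (rule compact_Int_closed)
  then show ?thesis using assms by (simp add: Int_absorb1)
qed

text \<open>The Arzela-Ascoli theorem. On an equicontinuous set of functions, pointwise convergence and
  uniform convergence on compact sets induce the same topology, so compactness can be transported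
  from a product of compact intervals along \<open>Abs_cpath\<close>.\<close>

lemma compact_cpath_equicontinuous:
  assumes closed: "closed F"
    and zero: "\<And>f. f \<in> F \<Longrightarrow> cpath_apply f 0 = 0"
    and equi: "\<And>T e. 0 < e \<Longrightarrow> \<exists>d>0. \<forall>f\<in>F. \<forall>s\<in>{0..real T}. \<forall>t\<in>{0..real T}.
                 \<bar>s - t\<bar> \<le> d \<longrightarrow> \<bar>cpath_apply f s - cpath_apply f t\<bar> \<le> e"
  shows "compact F"
proof -
  define ok where "ok T e d \<longleftrightarrow> 0 < d \<and> (\<forall>f\<in>F. \<forall>s\<in>{0..real T}. \<forall>t\<in>{0..real T}.
      \<bar>s - t\<bar> \<le> d \<longrightarrow> \<bar>cpath_apply f s - cpath_apply f t\<bar> \<le> e)" for T e d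
  define d where "d T e = (SOME x. ok T e x)" for T e
  have ok: "ok T e (d T e)" if "0 < e" for T e
    unfolding d_def
  proof (rule someI_ex)
    show "\<exists>x. ok T e x" unfolding ok_def using equi[OF that, of T] .
  qed
  have d1: "0 < d T e" if "0 < e" for T e
    using ok[OF that, of T] unfolding ok_def by (rule conjunct1)
  have d2: "\<bar>cpath_apply f s - cpath_apply f t\<bar> \<le> e"
    if "0 < e" "f \<in> F" "s \<in> {0..real T}" "t \<in> {0..real T}" "\<bar>s - t\<bar> \<le> d T e" for T e f s t
    using ok[OF that(1), of T, unfolded ok_def, THEN conjunct2, THEN bspec, OF that(2),
        THEN bspec, OF that(3), THEN bspec, OF that(4)] that(5) by (rule mp)
  \<comment> \<open>The same modulus conditions, imposed on plain functions. Off the half-line the value is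
     pinned, so that every coordinate of the product ranges over a bounded set.\<close>
  define G where "G = {g :: real \<Rightarrow> real. g 0 = 0 \<and> (\<forall>t<0. g t = undefined) \<and>
     (\<forall>T. \<forall>e>0. \<forall>s\<in>{0..real T}. \<forall>t\<in>{0..real T}. \<bar>s - t\<bar> \<le> d T e \<longrightarrow> \<bar>g s - g t\<bar> \<le> e)}"
  have GD: "\<bar>g s - g t\<bar> \<le> e"
    if "g \<in> G" "0 < e" "s \<in> {0..real T}" "t \<in> {0..real T}" "\<bar>s - t\<bar> \<le> d T e" for g T e s t
    using that(1)[unfolded G_def, THEN CollectD, THEN conjunct2, THEN conjunct2,
        rule_format, OF that(2-5)] .
  have "closed G"
  proof -
    have "closed {g :: real \<Rightarrow> real. \<bar>g s - g t\<bar> \<le> e}" for s t e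
      by (intro closed_Collect_le continuous_on_rabs continuous_on_diff continuous_on_const
          continuous_on_product_coordinates)
    moreover have "closed {g :: real \<Rightarrow> real. g t = c}" for t c
      by (intro closed_Collect_eq continuous_on_const continuous_on_product_coordinates)
    ultimately show ?thesis
      unfolding G_def Ball_def
      by (intro closed_Collect_conj closed_Collect_all closed_Collect_imp open_Collect_const)
  qed
  moreover have "\<exists>b. \<forall>g\<in>G. \<bar>g t\<bar> \<le> b" for t
  proof (cases "t < 0")
    case True
    then show ?thesis by (intro exI[of _ "\<bar>undefined\<bar>"]) (auto simp: G_def)
  next
    case False
    obtain T :: nat where T: "t \<le> real T" using real_arch_simple by blast
    obtain N where N: "t / d T 1 < real N" using reals_Archimedean2 by blast
    have "\<bar>g t\<bar> \<le> real (Suc N)" if g: "g \<in> G" for g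
    proof (rule bounded_by_steps[where f = g and t = t and N = "Suc N"])
      show "\<bar>g u - g v\<bar> \<le> 1"
        if "u \<in> {0..t}" "v \<in> {0..t}" "\<bar>u - v\<bar> \<le> t / real (Suc N)" for u v
      proof -
        have "t \<le> d T 1 * real (Suc N)"
          using N d1[of 1 T] by (simp add: field_simps)
        then have "t / real (Suc N) \<le> d T 1" by (simp add: field_simps)
        then show ?thesis using that g T by (intro GD[of g 1 u T v]) auto
      qed
    qed (use g False in \<open>auto simp: G_def\<close>)
    then show ?thesis by blast
  qed
  then have "\<forall>t. \<exists>b. \<forall>g\<in>G. \<bar>g t\<bar> \<le> b" by blast
  from choice[OF this] obtain B where "\<forall>t. \<forall>g\<in>G. \<bar>g t\<bar> \<le> B t" ..
  have "- B t \<le> g t \<and> g t \<le> B t" if "g \<in> G" for g t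
  proof -
    from \<open>\<forall>t. \<forall>g\<in>G. \<bar>g t\<bar> \<le> B t\<close> that have "\<bar>g t\<bar> \<le> B t" by blast
    then show ?thesis by linarith
  qed
  then have "G \<subseteq> (\<Pi>\<^sub>E t\<in>UNIV. {- B t .. B t})" by auto
  ultimately have compG: "compact G" by (rule compact_pointwise_closed)
  have G_cont: "continuous_on {0..} g" if g: "g \<in> G" for g
    unfolding continuous_on_iff
  proof (intro ballI allI impI)
    fix s e :: real assume s: "s \<in> {0..}" and e: "0 < e"
    obtain T :: nat where T: "s + 1 \<le> real T" using real_arch_simple by blast
    show "\<exists>h>0. \<forall>t\<in>{0..}. dist t s < h \<longrightarrow> dist (g t) (g s) < e"
    proof (intro exI[of _ "min 1 (d T (e/2))"] conjI ballI impI)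
      fix t assume "t \<in> {0..}" "dist t s < min 1 (d T (e / 2))"
      then have "\<bar>g t - g s\<bar> \<le> e / 2"
        using g s T e by (intro GD[of g "e/2" t T s]) (auto simp: dist_real_def)
      then show "dist (g t) (g s) < e" using e by (simp add: dist_real_def)
    qed (use d1 e in auto)
  qed
  have G_path: "cpath_apply (Abs_cpath g) = g" if "g \<in> G" for g
    using that G_cont[OF that] by (intro Abs_cpath_inverse) (auto simp: G_def extensional_def)
  have F_G: "cpath_apply f \<in> G" if "f \<in> F" for f
    unfolding G_def
  proof (intro CollectI conjI allI impI ballI)
    show "cpath_apply f t = undefined" if "t < 0" for t
      using cpath_apply[of f] that by (simp add: extensional_def)
    show "\<bar>cpath_apply f s - cpath_apply f t\<bar> \<le> e"
      if "0 < e" "s \<in> {0..real T}" "t \<in> {0..real T}" "\<bar>s - t\<bar> \<le> d T e" for T e s t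
      using that \<open>f \<in> F\<close> by (intro d2[of e f s T t])
  qed (use zero that in simp)
  \<comment> \<open>On \<open>G\<close>, closeness at a finite \<open>h\<close>-net of a compact set spreads to the whole set, because
     all members share the modulus \<open>d\<close>.\<close>
  have "continuous_on G Abs_cpath"
    unfolding continuous_on_open_invariant
  proof (intro allI impI)
    fix U :: "cpath set" assume U: "open U"
    have "\<exists>A. open A \<and> A \<inter> G \<subseteq> Abs_cpath -` U \<and> g \<in> A" if g: "g \<in> G" "Abs_cpath g \<in> U" for g
    proof -
      obtain K e where K: "compact K" "K \<subseteq> {0..}" and e: "0 < e" and
        sub: "{h. \<forall>t\<in>K. \<bar>cpath_apply h t - g t\<bar> < e} \<subseteq> U"
        using bspec[OF U[unfolded open_cpath_def] g(2)] unfolding G_path[OF g(1)] by blast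
      obtain b where b: "\<And>t. t \<in> K \<Longrightarrow> \<bar>t\<bar> \<le> b"
        using compact_imp_bounded[OF K(1)] unfolding bounded_iff by auto
      obtain T :: nat where T: "b \<le> real T" using real_arch_simple by blast
      have KT: "K \<subseteq> {0..real T}" using K b T by fastforce
      define h where "h = d T (e/4)"
      have h: "h > 0" using d1 e unfolding h_def by simp
      have "K \<subseteq> (\<Union>p\<in>K. ball p h)" using h by force
      then obtain P where P: "P \<subseteq> K" "finite P" "K \<subseteq> (\<Union>p\<in>P. ball p h)"
        by (rule compactE_image[OF K(1) open_ball])
      define A where "A = {f :: real \<Rightarrow> real. \<forall>p\<in>P. \<bar>f p - g p\<bar> < e/4}"
      have "open A"
      proof -
        have "A = (\<Inter>p\<in>P. {f. \<bar>f p - g p\<bar> < e/4})" by (auto simp: A_def)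
        also have "open \<dots>"
          using P(2) by (intro open_INT ballI open_Collect_less continuous_on_rabs
              continuous_on_diff continuous_on_const continuous_on_product_coordinates)
        finally show ?thesis .
      qed
      moreover have "g \<in> A" using e by (simp add: A_def)
      moreover have "Abs_cpath f \<in> U" if f: "f \<in> A" "f \<in> G" for f
      proof -
        have "\<bar>f t - g t\<bar> < e" if t: "t \<in> K" for t
        proof -
          obtain p where p: "p \<in> P" "dist p t < h" using P t by auto
          have "\<bar>k t - k p\<bar> \<le> e/4" if "k \<in> G" for k
          proof -
            have "t \<in> {0..real T}" "p \<in> {0..real T}" "\<bar>t - p\<bar> \<le> d T (e/4)"
              using KT t p P by (auto simp: h_def dist_real_def)
            then show ?thesis using that e by (intro GD[of k "e/4" t T p]) auto
          qed
          from this[OF f(2)] this[OF g(1)] have "\<bar>f t - f p\<bar> \<le> e/4" "\<bar>g t - g p\<bar> \<le> e/4" .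
          moreover have "\<bar>f p - g p\<bar> < e/4" using f p by (simp add: A_def)
          ultimately show ?thesis by linarith
        qed
        then show ?thesis using sub G_path[OF f(2)] by auto
      qed
      ultimately show ?thesis by blast
    qed
    then show "\<exists>A. open A \<and> A \<inter> G = Abs_cpath -` U \<inter> G"
      by (intro exI[of _ "\<Union>{A. open A \<and> A \<inter> G \<subseteq> Abs_cpath -` U}"] conjI open_Union) blast+
  qed
  then have "compact (Abs_cpath ` G)" using compG by (rule compact_continuous_image)
  then have "compact (Abs_cpath ` G \<inter> F)" using closed by (rule compact_Int_closed)
  moreover have "F \<subseteq> Abs_cpath ` G"
    using F_G by (metis cpath_apply_inverse image_eqI subsetI)
  ultimately show ?thesis by (simp add: Int_absorb1)
qed

section \<open>Chaining along dyadic points\<close>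

text \<open>The dyadic points \<open>\<lfloor>2 ^ j t\<rfloor> / 2 ^ j\<close> converge to \<open>t\<close>, and passing from level \<open>j\<close> to
  level \<open>j + 1\<close> either stays put or moves to the right neighbour. The total displacement of \<open>f\<close>
  along this chain is a geometric tail.\<close>

lemma dyadic_approximation:
  fixes f :: "real \<Rightarrow> real"
  assumes cont: "continuous_on {0..} f"
    and steps: "\<And>i j. \<lbrakk>m < j; i < j * 2 ^ j\<rbrakk> \<Longrightarrow> \<bar>f (real (i + 1) / 2 ^ j) - f (real i / 2 ^ j)\<bar> \<le> (9/10) ^ j"
    and t: "0 \<le> t" "t < real m"
  shows "\<bar>f t - f (real (nat \<lfloor>2 ^ m * t\<rfloor>) / 2 ^ m)\<bar> \<le> 9 * (9/10) ^ m"
proof -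
  define p where "p j = nat \<lfloor>2 ^ j * t\<rfloor>" for j
  have p: "real (p j) \<le> 2 ^ j * t" "2 ^ j * t < real (p j) + 1" for j
    using t unfolding p_def by simp_all
  have step: "\<bar>f (real (p (Suc j)) / 2 ^ Suc j) - f (real (p j) / 2 ^ j)\<bar> \<le> (9/10) ^ Suc j"
    if "m \<le> j" for j
  proof -
    have "real (2 * p j) < real (p (Suc j) + 1)" "real (p (Suc j)) < real (2 * p j + 2)"
      using p[of j] p[of "Suc j"] by simp_all
    then have "p (Suc j) = 2 * p j \<or> p (Suc j) = 2 * p j + 1" by linarith
    moreover have "2 * p j < Suc j * 2 ^ Suc j"
    proof -
      have "real (p j) < 2 ^ j * real m" using p(1)[of j] t
        by (meson le_less_trans mult_strict_left_mono zero_less_numeral zero_less_power)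
      also have "\<dots> \<le> 2 ^ j * real (Suc j)" using that by (intro mult_left_mono) auto
      finally have "real (p j) < real (2 ^ j * Suc j)" by (simp add: algebra_simps)
      then have "p j < 2 ^ j * Suc j" by (rule of_nat_less_imp_less)
      then show ?thesis by (simp add: algebra_simps)
    qed
    then have "\<bar>f (real (2 * p j + 1) / 2 ^ Suc j) - f (real (2 * p j) / 2 ^ Suc j)\<bar> \<le> (9/10) ^ Suc j"
      using that by (intro steps) auto
    moreover have "real (2 * p j) / 2 ^ Suc j = real (p j) / 2 ^ j" by simp
    ultimately show ?thesis by (elim disjE) simp_all
  qed
  \<comment> \<open>The geometric sum of \<open>(9/10) ^ j\<close> over \<open>m < j \<le> m + k\<close>.\<close>
  have "\<bar>f (real (p (m + k)) / 2 ^ (m + k)) - f (real (p m) / 2 ^ m)\<bar> \<le> 9 * (9/10) ^ m * (1 - (9/10) ^ k)" for k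
  proof (induction k)
    case (Suc k)
    have "9 * (9/10) ^ m * (1 - (9/10) ^ Suc k) = 9 * (9/10) ^ m * (1 - (9/10) ^ k) + (9/10 :: real) ^ Suc (m + k)"
      by (simp add: power_add algebra_simps)
    moreover have "\<bar>f (real (p (m + Suc k)) / 2 ^ (m + Suc k)) - f (real (p (m + k)) / 2 ^ (m + k))\<bar>
        \<le> (9/10) ^ Suc (m + k)"
      unfolding add_Suc_right by (rule step) simp
    ultimately show ?case using Suc by linarith
  qed simp
  moreover have "9 * (9/10) ^ m * (1 - (9/10) ^ k) \<le> (9 * (9/10) ^ m :: real)" for k
    by (simp add: mult_le_cancel_left2)
  ultimately have le: "\<bar>f (real (p (m + k)) / 2 ^ (m + k)) - f (real (p m) / 2 ^ m)\<bar> \<le> 9 * (9/10) ^ m" for k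
    by (rule order_trans)
  have "(\<lambda>j. real (p j) / 2 ^ j) \<longlonglongrightarrow> t"
  proof (rule real_tendsto_sandwich)
    show "\<forall>\<^sub>F j in sequentially. t - (1/2) ^ j \<le> real (p j) / 2 ^ j"
    proof (intro always_eventually allI)
      fix j
      have "t < (real (p j) + 1) / 2 ^ j" using p(2)[of j] by (simp add: field_simps)
      then show "t - (1/2) ^ j \<le> real (p j) / 2 ^ j"
        by (simp add: add_divide_distrib power_one_over)
    qed
    show "\<forall>\<^sub>F j in sequentially. real (p j) / 2 ^ j \<le> t"
    proof (intro always_eventually allI)
      show "real (p j) / 2 ^ j \<le> t" for j
        using p(1)[of j] by (simp add: field_simps)
    qed
    have "(\<lambda>j. t - (1/2) ^ j) \<longlonglongrightarrow> t - 0"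
      by (intro tendsto_diff tendsto_const LIMSEQ_power_zero) simp
    then show "(\<lambda>j. t - (1/2) ^ j) \<longlonglongrightarrow> t" by simp
  qed simp
  then have "(\<lambda>k. real (p (k + m)) / 2 ^ (k + m)) \<longlonglongrightarrow> t" by (rule LIMSEQ_ignore_initial_segment)
  then have lim: "(\<lambda>k. real (p (m + k)) / 2 ^ (m + k)) \<longlonglongrightarrow> t" by (simp add: add.commute)
  have "(\<lambda>k. f (real (p (m + k)) / 2 ^ (m + k))) \<longlonglongrightarrow> f t"
    using t by (intro continuous_on_tendsto_compose[OF cont lim]) auto
  then have "(\<lambda>k. \<bar>f (real (p (m + k)) / 2 ^ (m + k)) - f (real (p m) / 2 ^ m)\<bar>)
      \<longlonglongrightarrow> \<bar>f t - f (real (p m) / 2 ^ m)\<bar>"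
    by (intro tendsto_intros)
  then show ?thesis
    unfolding p_def[symmetric] by (rule LIMSEQ_le_const2) (use le in blast)
qed

text \<open>Points at distance at most \<open>2 ^ (- m)\<close> are chained to equal or neighbouring dyadic points of
  level \<open>m\<close>: two chains cost \<open>9 (9/10) ^ m\<close> each, and the step between their ends \<open>(9/10) ^ m\<close>.\<close>

lemma dyadic_modulus:
  fixes f :: "real \<Rightarrow> real"
  assumes cont: "continuous_on {0..} f"
    and steps: "\<And>i j. \<lbrakk>m \<le> j; i < j * 2 ^ j\<rbrakk> \<Longrightarrow> \<bar>f (real (i + 1) / 2 ^ j) - f (real i / 2 ^ j)\<bar> \<le> (9/10) ^ j"
    and s: "0 \<le> s" "s \<le> t" and t: "t < real m" "t - s \<le> 1 / 2 ^ m"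
  shows "\<bar>f s - f t\<bar> \<le> 19 * (9/10) ^ m"
proof -
  define p where "p u = nat \<lfloor>2 ^ m * u\<rfloor>" for u :: real
  have p: "real (p u) \<le> 2 ^ m * u" "2 ^ m * u < real (p u) + 1" if "0 \<le> u" for u
    using that unfolding p_def by simp_all
  have near: "\<bar>f u - f (real (p u) / 2 ^ m)\<bar> \<le> 9 * (9/10) ^ m" if "0 \<le> u" "u < real m" for u
    unfolding p_def using that by (intro dyadic_approximation cont steps) auto
  have "2 ^ m * t \<le> 2 ^ m * s + 1" using t(2) by (simp add: field_simps)
  moreover have "2 ^ m * s \<le> 2 ^ m * t" using s by simp
  ultimately have "real (p t) < real (p s + 2)" "real (p s) < real (p t + 1)"
    using p[of s] p[of t] s by linarith+
  then consider "p t = p s" | "p t = p s + 1" by linarith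
  then have "\<bar>f (real (p t) / 2 ^ m) - f (real (p s) / 2 ^ m)\<bar> \<le> (9/10) ^ m"
  proof cases
    case 2
    have "real (p s) < 2 ^ m * real m"
      using p(1)[of s] s t
      by (meson le_less_trans mult_strict_left_mono zero_less_numeral zero_less_power)
    then have "real (p s) < real (m * 2 ^ m)" by (simp add: mult.commute)
    then have "p s < m * 2 ^ m" by (rule of_nat_less_imp_less)
    then show ?thesis unfolding 2 by (intro steps) auto
  qed simp
  with near[of s] near[of t] s t show ?thesis by linarith
qed

text \<open>At level \<open>j\<close> the index \<open>i\<close> runs over the window \<open>[0, j]\<close>. Letting the window grow with the
  level makes one sequence of conditions control all compact time intervals at once. A common ratio
  \<open>r\<close> in place of 9/10 serves the purpose whenever \<open>r < 1\<close>, for chaining, and \<open>2 r\<^sup>4 > 1\<close>, for the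
  union bound.\<close>

definition dyadic_holder_paths :: "nat \<Rightarrow> cpath set" where
  "dyadic_holder_paths J = {f. cpath_apply f 0 = 0 \<and>
     (\<forall>j\<ge>J. \<forall>i<j * 2 ^ j. \<bar>cpath_apply f (real (i + 1) / 2 ^ j) - cpath_apply f (real i / 2 ^ j)\<bar> \<le> (9/10) ^ j)}"

lemma closed_dyadic_holder_paths: "closed (dyadic_holder_paths J)"
  unfolding dyadic_holder_paths_def
  by (intro closed_Collect_conj closed_Collect_all closed_Collect_imp open_Collect_const
      closed_Collect_eq closed_Collect_le continuous_on_rabs continuous_on_diff
      continuous_on_const continuous_on_cpath_apply) simp_all

lemma compact_dyadic_holder_paths: "compact (dyadic_holder_paths J)"
proof (rule compact_cpath_equicontinuous)
  show "closed (dyadic_holder_paths J)" by (rule closed_dyadic_holder_paths)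
  show "cpath_apply f 0 = 0" if "f \<in> dyadic_holder_paths J" for f
    using that by (simp add: dyadic_holder_paths_def)
  fix T :: nat and e :: real assume e: "0 < e"
  obtain k where k: "(9/10 :: real) ^ k < e / 19"
    using real_arch_pow_inv[of "e / 19" "9/10 :: real"] e by auto
  define m where "m = Suc (k + J + T)"
  have "(9/10 :: real) ^ m \<le> (9/10) ^ k" unfolding m_def by (intro power_decreasing) auto
  then have "(9/10 :: real) ^ m \<le> e / 19" using k by linarith
  then have m: "19 * (9/10 :: real) ^ m \<le> e" by simp
  show "\<exists>d>0. \<forall>f\<in>dyadic_holder_paths J. \<forall>s\<in>{0..real T}. \<forall>t\<in>{0..real T}.
          \<bar>s - t\<bar> \<le> d \<longrightarrow> \<bar>cpath_apply f s - cpath_apply f t\<bar> \<le> e"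
  proof (intro exI[of _ "1 / 2 ^ m"] conjI ballI impI)
    fix f s t assume f: "f \<in> dyadic_holder_paths J" and st: "s \<in> {0..real T}" "t \<in> {0..real T}"
      and d: "\<bar>s - t\<bar> \<le> 1 / 2 ^ m"
    have *: "\<bar>cpath_apply f u - cpath_apply f v\<bar> \<le> 19 * (9/10) ^ m"
      if "0 \<le> u" "u \<le> v" "v \<le> real T" "v - u \<le> 1 / 2 ^ m" for u v
    proof (rule dyadic_modulus[where f = "cpath_apply f" and m = m and s = u and t = v])
      show "continuous_on {0..} (cpath_apply f)" using cpath_apply[of f] by simp
      show "\<bar>cpath_apply f (real (i + 1) / 2 ^ j) - cpath_apply f (real i / 2 ^ j)\<bar> \<le> (9/10) ^ j"
        if "m \<le> j" "i < j * 2 ^ j" for i j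
      proof -
        have "J \<le> j" using that(1) by (simp add: m_def)
        then show ?thesis using f that(2) unfolding dyadic_holder_paths_def by blast
      qed
    qed (use that in \<open>simp_all add: m_def\<close>)
    have "\<bar>cpath_apply f s - cpath_apply f t\<bar> \<le> 19 * (9/10) ^ m"
    proof (cases "s \<le> t")
      case True
      then show ?thesis using st d by (intro *) auto
    next
      case False
      then have "\<bar>cpath_apply f t - cpath_apply f s\<bar> \<le> 19 * (9/10) ^ m"
        using st d by (intro *) auto
      then show ?thesis by (simp add: abs_minus_commute)
    qed
    then show "\<bar>cpath_apply f s - cpath_apply f t\<bar> \<le> e" using m by linarith
  qed simp
qed

text \<open>The shape needed for the union bound over levels and neighbouring dyadic points.\<close>

lemma compl_dyadic_holder_paths:
  "- dyadic_holder_paths J = {f. cpath_apply f 0 \<noteq> 0} \<union> (\<Union>j. \<Union>i<(j + J) * 2 ^ (j + J).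
     {f. (9/10) ^ (j + J) < \<bar>cpath_apply f (real (i + 1) / 2 ^ (j + J)) - cpath_apply f (real i / 2 ^ (j + J))\<bar>})"
    (is "_ = ?Z \<union> (\<Union>j. ?B (j + J))")
proof -
  have compl: "- {f. z f = 0 \<and> (\<forall>j\<ge>J. \<forall>i<N j. d f i j \<le> r j)} =
      {f. z f \<noteq> 0} \<union> (\<Union>j\<in>{J..}. \<Union>i<N j. {f. r j < d f i j})"
    for z :: "cpath \<Rightarrow> real" and d :: "cpath \<Rightarrow> nat \<Rightarrow> nat \<Rightarrow> real" and r and N :: "nat \<Rightarrow> nat"
    by (intro set_eqI, simp only: Compl_iff mem_Collect_eq Un_iff UN_iff lessThan_iff atLeast_iff
        not_le[symmetric] de_Morgan_conj Bex_def) blast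
  have "- dyadic_holder_paths J = ?Z \<union> (\<Union>j\<in>{J..}. ?B j)"
    unfolding dyadic_holder_paths_def by (rule compl)
  also have "{J..} = range (\<lambda>j. j + J)"
    by (auto simp: image_iff intro: le_add_diff_inverse2[symmetric])
  finally show ?thesis by (simp only: image_image)
qed

section \<open>Measurability of the rescaled walk\<close>

lemma cpath_apply_rescaled_path:
  "0 \<le> t \<Longrightarrow> cpath_apply (rescaled_path n s) t = linear_interp s (real n * t) / sqrt (real n)"
  by (simp add: rescaled_path.rep_eq)

text \<open>Membership in an open set is decided by the path on a compact time set, hence by finitely many
  positions of the walk.\<close>

lemma rescaled_path_finite_dependence:
  assumes "open U" "rescaled_path n s \<in> U"
  shows "\<exists>N. \<forall>s'. (\<forall>k<N. s' k = s k) \<longrightarrow> rescaled_path n s' \<in> U"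
proof -
  obtain K e where K: "compact K" "K \<subseteq> {0..}" and e: "0 < e" and
    sub: "{g. \<forall>t\<in>K. \<bar>cpath_apply g t - cpath_apply (rescaled_path n s) t\<bar> < e} \<subseteq> U"
    using bspec[OF assms(1)[unfolded open_cpath_def] assms(2)] by blast
  obtain b where b: "\<And>t. t \<in> K \<Longrightarrow> \<bar>t\<bar> \<le> b"
    using compact_imp_bounded[OF K(1)] unfolding bounded_iff by auto
  obtain N :: nat where N: "real n * b < real N" using reals_Archimedean2 by blast
  have "rescaled_path n s' \<in> U" if s': "\<forall>k<Suc N. s' k = s k" for s'
  proof -
    have "cpath_apply (rescaled_path n s') t = cpath_apply (rescaled_path n s) t" if "t \<in> K" for t
    proof -
      have t: "0 \<le> t" "t \<le> b" using K(2) b[OF that] that by auto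
      have "real n * t \<le> real n * b" using t by (intro mult_left_mono) auto
      then have "\<lfloor>real n * t\<rfloor> < int N" using N by linarith
      then have "nat \<lfloor>real n * t\<rfloor> < N" using t by (simp add: nat_less_iff)
      then show ?thesis using s' t by (simp add: cpath_apply_rescaled_path linear_interp_def)
    qed
    then show ?thesis using sub e by auto
  qed
  then show ?thesis by blast
qed

text \<open>By finite dependence, the preimage of an open set is a union of cylinders over finite words of
  integers, and there are only countably many words.\<close>

lemma measurable_skew_process:
  assumes [measurable]: "\<And>k. S k \<in> measurable M (count_space UNIV)"
  shows "skew_process S n \<in> measurable M borel"
proof (rule borel_measurableI)
  fix U :: "cpath set" assume U: "open U"
  \<comment> \<open>The finite words whose cylinder is mapped into \<open>U\<close>.\<close>
  define C where "C = {xs :: int list. \<forall>s. (\<forall>k<length xs. s k = xs ! k) \<longrightarrow> rescaled_path n s \<in> U}"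
  have "skew_process S n -` U \<inter> space M = (\<Union>xs\<in>C. {\<omega> \<in> space M. \<forall>k<length xs. S k \<omega> = xs ! k})"
  proof (intro equalityI subsetI)
    fix \<omega> assume \<omega>: "\<omega> \<in> skew_process S n -` U \<inter> space M"
    then have "rescaled_path n (\<lambda>k. S k \<omega>) \<in> U" by (simp add: skew_process_def)
    then obtain N where N: "\<And>s'. (\<forall>k<N. s' k = S k \<omega>) \<Longrightarrow> rescaled_path n s' \<in> U"
      using rescaled_path_finite_dependence[OF U] by blast
    have "map (\<lambda>k. S k \<omega>) [0..<N] \<in> C" using N by (simp add: C_def)
    then show "\<omega> \<in> (\<Union>xs\<in>C. {\<omega> \<in> space M. \<forall>k<length xs. S k \<omega> = xs ! k})"
      using \<omega> by (intro UN_I[of "map (\<lambda>k. S k \<omega>) [0..<N]"]) auto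
  qed (auto simp: C_def skew_process_def)
  also have "\<dots> \<in> sets M"
  proof (intro sets.countable_UN' image_subsetI)
    show "{\<omega> \<in> space M. \<forall>k<length xs. S k \<omega> = xs ! k} \<in> sets M" for xs
      by measurable
  qed simp
  finally show "skew_process S n -` U \<inter> space M \<in> sets M" .
qed

section \<open>One step of a Markov chain\<close>

lemma nn_integral_countable_variable:
  fixes Z :: "'a \<Rightarrow> 'z::countable" and f :: "'z \<Rightarrow> ennreal"
  assumes Z: "Z \<in> measurable M (count_space UNIV)"
  shows "(\<integral>\<^sup>+\<omega>. f (Z \<omega>) \<partial>M) = (\<integral>\<^sup>+z. f z * emeasure M {\<omega> \<in> space M. Z \<omega> = z} \<partial>count_space UNIV)"
proof -
  have "distr M (count_space UNIV) Z = density (count_space UNIV) (\<lambda>z. emeasure M {\<omega> \<in> space M. Z \<omega> = z})"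
  proof (rule measure_eqI_countable[where A = UNIV])
    fix z
    have "emeasure (distr M (count_space UNIV) Z) {z} = emeasure M {\<omega> \<in> space M. Z \<omega> = z}"
      using Z by (subst emeasure_distr) (auto intro!: arg_cong[where f = "emeasure M"])
    also have "\<dots> = emeasure (density (count_space UNIV) (\<lambda>z. emeasure M {\<omega> \<in> space M. Z \<omega> = z})) {z}"
      by (subst emeasure_density) (simp_all add: nn_integral_indicator_singleton)
    finally show "emeasure (distr M (count_space UNIV) Z) {z} = \<dots>" .
  qed simp_all
  then have "(\<integral>\<^sup>+z. f z \<partial>distr M (count_space UNIV) Z) =
      (\<integral>\<^sup>+z. f z * emeasure M {\<omega> \<in> space M. Z \<omega> = z} \<partial>count_space UNIV)"
    by (simp add: nn_integral_density mult.commute)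
  then show ?thesis using Z by (simp add: nn_integral_distr)
qed

text \<open>The defining conditional probability without the division, so that it also covers histories of
  probability 0.\<close>

lemma markov_chain_history_step:
  assumes "markov_chain M S p"
  shows "emeasure M {\<omega> \<in> space M. (\<forall>i\<le>k. S i \<omega> = x i) \<and> S (Suc k) \<omega> = y} =
    ennreal (p (x k) y) * emeasure M {\<omega> \<in> space M. \<forall>i\<le>k. S i \<omega> = x i}"
proof -
  interpret prob_space M using assms by (simp add: markov_chain_def)
  have S[measurable]: "S k \<in> measurable M (count_space UNIV)" for k
    using assms by (simp add: markov_chain_def)
  let ?H = "{\<omega> \<in> space M. \<forall>i\<le>k. S i \<omega> = x i}"
  let ?A = "{\<omega> \<in> space M. (\<forall>i\<le>k. S i \<omega> = x i) \<and> S (Suc k) \<omega> = y}"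
  have "?H \<in> sets M" by measurable
  then have le: "measure M ?A \<le> measure M ?H" by (intro finite_measure_mono) auto
  show ?thesis
  proof (cases "measure M ?H > 0")
    case True
    then have "\<P>(\<omega> in M. S (Suc k) \<omega> = y \<bar> \<forall>i\<le>k. S i \<omega> = x i) = p (x k) y"
      using assms by (simp add: markov_chain_def)
    moreover have "\<P>(\<omega> in M. S (Suc k) \<omega> = y \<bar> \<forall>i\<le>k. S i \<omega> = x i) = measure M ?A / measure M ?H"
      by (simp add: cond_prob_def conj_commute)
    ultimately have p: "p (x k) y = measure M ?A / measure M ?H" by simp
    then have "measure M ?A = p (x k) y * measure M ?H" "p (x k) y \<ge> 0"
      using True by simp_all
    then show ?thesis by (simp add: emeasure_eq_measure ennreal_mult)
  next
    case False
    then have "measure M ?H = 0" using measure_nonneg[of M ?H] by linarith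
    moreover have "measure M ?A = 0" using le calculation measure_nonneg[of M ?A] by linarith
    ultimately show ?thesis by (simp add: emeasure_eq_measure)
  qed
qed

text \<open>The Markov property for functionals of one past state, the present and the next one: sum
  \<open>markov_chain_history_step\<close> over all histories up to time \<open>k\<close>.\<close>

lemma markov_chain_one_step:
  fixes F :: "'s::countable \<Rightarrow> 's \<Rightarrow> 's \<Rightarrow> ennreal"
  assumes mc: "markov_chain M S p" and "s \<le> k"
  shows "(\<integral>\<^sup>+\<omega>. F (S s \<omega>) (S k \<omega>) (S (Suc k) \<omega>) \<partial>M) =
    (\<integral>\<^sup>+\<omega>. (\<integral>\<^sup>+y. ennreal (p (S k \<omega>) y) * F (S s \<omega>) (S k \<omega>) y \<partial>count_space UNIV) \<partial>M)"
proof -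
  have S[measurable]: "S k \<in> measurable M (count_space UNIV)" for k
    using mc by (simp add: markov_chain_def)
  define H where "H \<omega> = map (\<lambda>i. S i \<omega>) [0..<Suc k]" for \<omega>
  have H_nth: "H \<omega> ! s = S s \<omega>" "H \<omega> ! k = S k \<omega>" for \<omega>
    using \<open>s \<le> k\<close> unfolding H_def by (simp_all only: nth_map_upt)  simp_all
  have H_eq: "H \<omega> = xs \<longleftrightarrow> length xs = Suc k \<and> (\<forall>i\<le>k. S i \<omega> = xs ! i)" for \<omega> xs
    unfolding H_def list_eq_iff_nth_eq by (auto simp: less_Suc_eq_le simp del: upt_Suc)
  have H[measurable]: "H \<in> measurable M (count_space UNIV)"
  proof (subst measurable_count_space_eq_countable, safe)
    show "H -` {xs} \<inter> space M \<in> sets M" for xs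
    proof -
      have "H -` {xs} \<inter> space M = {\<omega> \<in> space M. H \<omega> = xs}" by auto
      also have "\<dots> = {\<omega> \<in> space M. length xs = Suc k \<and> (\<forall>i\<le>k. S i \<omega> = xs ! i)}"
        by (simp only: H_eq)
      also have "\<dots> \<in> sets M" by measurable
      finally show ?thesis .
    qed
  qed simp_all
  define Fs where "Fs xs = F (xs ! s) (xs ! k)" for xs
  let ?e = "\<lambda>xs. emeasure M {\<omega> \<in> space M. H \<omega> = xs}"
  have step: "emeasure M {\<omega> \<in> space M. (H \<omega>, S (Suc k) \<omega>) = (xs, y)} = ennreal (p (xs ! k) y) * ?e xs" for xs y
  proof (cases "length xs = Suc k")
    case True
    then show ?thesis using markov_chain_history_step[OF mc, of k "(!) xs" y] by (simp add: H_eq)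
  qed (simp add: H_eq)
  have "(\<integral>\<^sup>+\<omega>. F (S s \<omega>) (S k \<omega>) (S (Suc k) \<omega>) \<partial>M) = (\<integral>\<^sup>+\<omega>. case_prod Fs (H \<omega>, S (Suc k) \<omega>) \<partial>M)"
    by (simp add: Fs_def H_nth)
  also have "\<dots> = (\<integral>\<^sup>+z. case_prod Fs z * emeasure M {\<omega> \<in> space M. (H \<omega>, S (Suc k) \<omega>) = z} \<partial>count_space UNIV)"
    by (rule nn_integral_countable_variable) measurable
  also have "\<dots> = (\<integral>\<^sup>+xs. \<integral>\<^sup>+y. Fs xs y * (ennreal (p (xs ! k) y) * ?e xs) \<partial>count_space UNIV \<partial>count_space UNIV)"
    by (subst nn_integral_fst_count_space[symmetric]) (simp only: step prod.case)
  also have "\<dots> = (\<integral>\<^sup>+xs. (\<integral>\<^sup>+y. ennreal (p (xs ! k) y) * Fs xs y \<partial>count_space UNIV) * ?e xs \<partial>count_space UNIV)"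
    by (intro nn_integral_cong, subst nn_integral_multc[symmetric]) (simp_all add: mult_ac)
  also have "\<dots> = (\<integral>\<^sup>+\<omega>. (\<integral>\<^sup>+y. ennreal (p (H \<omega> ! k) y) * Fs (H \<omega>) y \<partial>count_space UNIV) \<partial>M)"
    by (rule nn_integral_countable_variable[symmetric]) measurable
  finally show ?thesis by (simp add: Fs_def H_nth)
qed

lemma nn_integral_skew_transition:
  "(\<integral>\<^sup>+y. ennreal (skew_transition \<alpha> m y) * G y \<partial>count_space UNIV) =
    ennreal (skew_transition \<alpha> m (m + 1)) * G (m + 1) + ennreal (skew_transition \<alpha> m (m - 1)) * G (m - 1)"
  by (subst nn_integral_count_space'[where A = "{m + 1, m - 1}"]) (auto simp: skew_transition_def)

text \<open>A pointwise inequality for the transition probabilities becomes an inequality between expectations.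
  Iterating it in \<open>k\<close> with \<open>s\<close> fixed gives moment bounds for increments.\<close>

lemma skew_walk_expectation_step:
  fixes h :: "int \<Rightarrow> int \<Rightarrow> real"
  assumes \<alpha>: "0 < \<alpha>" "\<alpha> < 1" and mc: "markov_chain M S (skew_transition \<alpha>)" and "s \<le> k"
    and nonneg: "\<And>a y. 0 \<le> h a y"
    and bound: "\<And>a m. skew_transition \<alpha> m (m + 1) * h a (m + 1) + skew_transition \<alpha> m (m - 1) * h a (m - 1) \<le> G a m"
  shows "(\<integral>\<^sup>+\<omega>. ennreal (h (S s \<omega>) (S (Suc k) \<omega>)) \<partial>M) \<le> (\<integral>\<^sup>+\<omega>. ennreal (G (S s \<omega>) (S k \<omega>)) \<partial>M)"
proof -
  have p: "0 \<le> skew_transition \<alpha> m y" for m y using \<alpha> by (simp add: skew_transition_def)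
  have "(\<integral>\<^sup>+\<omega>. ennreal (h (S s \<omega>) (S (Suc k) \<omega>)) \<partial>M) =
      (\<integral>\<^sup>+\<omega>. (\<integral>\<^sup>+y. ennreal (skew_transition \<alpha> (S k \<omega>) y) * ennreal (h (S s \<omega>) y) \<partial>count_space UNIV) \<partial>M)"
    using markov_chain_one_step[OF mc \<open>s \<le> k\<close>, of "\<lambda>a m y. ennreal (h a y)"] .
  also have "\<dots> \<le> (\<integral>\<^sup>+\<omega>. ennreal (G (S s \<omega>) (S k \<omega>)) \<partial>M)"
    unfolding nn_integral_skew_transition
    by (intro nn_integral_mono)
      (simp add: ennreal_mult[symmetric] ennreal_plus[symmetric] p nonneg bound ennreal_leI
        del: ennreal_plus)
  finally show ?thesis .
qed

section \<open>The scale function of the skew walk\<close>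

text \<open>The scale function of the chain: up to an additive constant and a factor, the function that turns
  it into a martingale. At the origin the two slopes balance, as
  \<open>\<alpha> (1 - \<alpha>) - (1 - \<alpha>) \<alpha> = 0\<close>.\<close>

definition skew_scale :: "real \<Rightarrow> int \<Rightarrow> real" where
  "skew_scale \<alpha> m = (if 0 \<le> m then 1 - \<alpha> else \<alpha>) * real_of_int m"

text \<open>The step at the origin: \<open>1 - \<alpha>\<close> with probability \<open>\<alpha>\<close>, and \<open>- \<alpha>\<close> otherwise. It is
  centred with variance \<open>v = \<alpha> (1 - \<alpha>)\<close> and third moment \<open>v (1 - 2 \<alpha>)\<close>. This third moment
  contributes a term that is linear in \<open>D\<close>, which is absorbed into \<open>D\<^sup>2 + 1\<close>.\<close>

lemma centred_two_point_moments:
  fixes \<alpha> D :: real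
  assumes "0 < \<alpha>" "\<alpha> < 1"
  shows "\<alpha> * (D + (1 - \<alpha>))\<^sup>2 + (1 - \<alpha>) * (D - \<alpha>)\<^sup>2 \<le> D\<^sup>2 + 1"
    and "\<alpha> * (D + (1 - \<alpha>)) ^ 4 + (1 - \<alpha>) * (D - \<alpha>) ^ 4 \<le> D ^ 4 + 8 * D\<^sup>2 + 3"
proof -
  define v where "v = \<alpha> * (1 - \<alpha>)"
  have v: "0 \<le> v" "v \<le> 1" using assms by (auto simp: v_def mult_le_one)
  have "\<alpha> * (D + (1 - \<alpha>))\<^sup>2 + (1 - \<alpha>) * (D - \<alpha>)\<^sup>2 = D\<^sup>2 + v"
    unfolding v_def by algebra
  then show "\<alpha> * (D + (1 - \<alpha>))\<^sup>2 + (1 - \<alpha>) * (D - \<alpha>)\<^sup>2 \<le> D\<^sup>2 + 1" using v by linarith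
  define e where "e = 1 - 2 * \<alpha>"
  have e: "e\<^sup>2 = 1 - 4 * v" unfolding e_def v_def by algebra
  define Q where "Q = D\<^sup>2"
  define X where "X = e * D"
  have *: "\<alpha> * (D + (1 - \<alpha>)) ^ 4 + (1 - \<alpha>) * (D - \<alpha>) ^ 4 =
      D ^ 4 + 6 * (v * Q) + 4 * (v * X) + v * (1 - 3 * v)"
    unfolding Q_def X_def e_def v_def by algebra
  have "v * Q \<le> Q" using v by (simp add: mult_left_le_one_le Q_def)
  moreover have "v * X \<le> (Q + 1) / 2"
  proof -
    have "0 \<le> (e - D)\<^sup>2" by simp
    then have "2 * X \<le> e\<^sup>2 + Q"
      by (simp add: X_def Q_def power2_eq_square algebra_simps)
    then have "X \<le> (Q + 1) / 2" using e v by simp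
    then have "v * X \<le> v * ((Q + 1) / 2)" using v by (intro mult_left_mono)
    also have "\<dots> \<le> (Q + 1) / 2" using v by (intro mult_left_le_one_le) (auto simp: Q_def)
    finally show ?thesis .
  qed
  moreover have "v * (1 - 3 * v) \<le> 1"
    using mult_left_mono[of "1 - 3 * v" 1 v] v by simp
  ultimately show "\<alpha> * (D + (1 - \<alpha>)) ^ 4 + (1 - \<alpha>) * (D - \<alpha>) ^ 4 \<le> D ^ 4 + 8 * D\<^sup>2 + 3"
    unfolding * Q_def[symmetric] by argo
qed

lemma symmetric_two_point_moments:
  fixes c D :: real
  assumes "0 < c" "c < 1"
  shows "1/2 * (D + c)\<^sup>2 + 1/2 * (D - c)\<^sup>2 \<le> D\<^sup>2 + 1"
    and "1/2 * (D + c) ^ 4 + 1/2 * (D - c) ^ 4 \<le> D ^ 4 + 8 * D\<^sup>2 + 3"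
proof -
  have c: "c\<^sup>2 \<le> 1" "c ^ 4 \<le> 1" using assms by (simp_all add: power_le_one)
  have "1/2 * (D + c)\<^sup>2 + 1/2 * (D - c)\<^sup>2 = D\<^sup>2 + c\<^sup>2" by algebra
  then show "1/2 * (D + c)\<^sup>2 + 1/2 * (D - c)\<^sup>2 \<le> D\<^sup>2 + 1" using c by linarith
  have "1/2 * (D + c) ^ 4 + 1/2 * (D - c) ^ 4 = D ^ 4 + 6 * (c\<^sup>2 * D\<^sup>2) + c ^ 4" by algebra
  moreover have "c\<^sup>2 * D\<^sup>2 \<le> D\<^sup>2" using c by (intro mult_left_le_one_le) auto
  ultimately show "1/2 * (D + c) ^ 4 + 1/2 * (D - c) ^ 4 \<le> D ^ 4 + 8 * D\<^sup>2 + 3"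
    using c by (smt (verit) zero_le_power2)
qed

text \<open>Here \<open>b\<close> plays the role of the starting value of an increment. Averaged over the present state,
  the bounds say that one more step takes its second and fourth moments \<open>m\<^sub>2\<close> and \<open>m\<^sub>4\<close> to at most
  \<open>m\<^sub>2 + 1\<close> and \<open>m\<^sub>4 + 8 m\<^sub>2 + 3\<close>.\<close>

lemma skew_transition_moments:
  assumes "0 < \<alpha>" "\<alpha> < 1"
  defines "up \<equiv> \<lambda>m. skew_transition \<alpha> m (m + 1)" and "down \<equiv> \<lambda>m. skew_transition \<alpha> m (m - 1)"
  shows "up m * (skew_scale \<alpha> (m + 1) - b)\<^sup>2 + down m * (skew_scale \<alpha> (m - 1) - b)\<^sup>2
      \<le> (skew_scale \<alpha> m - b)\<^sup>2 + 1"
    and "up m * (skew_scale \<alpha> (m + 1) - b) ^ 4 + down m * (skew_scale \<alpha> (m - 1) - b) ^ 4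
      \<le> (skew_scale \<alpha> m - b) ^ 4 + 8 * (skew_scale \<alpha> m - b)\<^sup>2 + 3"
proof -
  consider "m = 0" | "0 < m" | "m < 0" by linarith
  then have "up m * (skew_scale \<alpha> (m + 1) - b)\<^sup>2 + down m * (skew_scale \<alpha> (m - 1) - b)\<^sup>2
      \<le> (skew_scale \<alpha> m - b)\<^sup>2 + 1 \<and>
     up m * (skew_scale \<alpha> (m + 1) - b) ^ 4 + down m * (skew_scale \<alpha> (m - 1) - b) ^ 4
      \<le> (skew_scale \<alpha> m - b) ^ 4 + 8 * (skew_scale \<alpha> m - b)\<^sup>2 + 3"
  proof cases
    case 1
    have eqs: "up m = \<alpha>" "down m = 1 - \<alpha>"
      "skew_scale \<alpha> (m + 1) - b = (skew_scale \<alpha> m - b) + (1 - \<alpha>)"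
      "skew_scale \<alpha> (m - 1) - b = (skew_scale \<alpha> m - b) - \<alpha>"
      using 1 by (simp_all add: up_def down_def skew_transition_def skew_scale_def)
    show ?thesis unfolding eqs by (intro conjI centred_two_point_moments assms)
  next
    case 2
    have eqs: "up m = 1/2" "down m = 1/2"
      "skew_scale \<alpha> (m + 1) - b = (skew_scale \<alpha> m - b) + (1 - \<alpha>)"
      "skew_scale \<alpha> (m - 1) - b = (skew_scale \<alpha> m - b) - (1 - \<alpha>)"
      using 2 by (simp_all add: up_def down_def skew_transition_def skew_scale_def algebra_simps)
    show ?thesis unfolding eqs
      by (intro conjI symmetric_two_point_moments) (use assms in simp_all)
  next
    case 3
    have "skew_scale \<alpha> (m + 1) = \<alpha> * real_of_int (m + 1)"
      using 3 by (cases "m = - 1") (simp_all add: skew_scale_def)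
    then have eqs: "up m = 1/2" "down m = 1/2"
      "skew_scale \<alpha> (m + 1) - b = (skew_scale \<alpha> m - b) + \<alpha>"
      "skew_scale \<alpha> (m - 1) - b = (skew_scale \<alpha> m - b) - \<alpha>"
      using 3 by (simp_all add: up_def down_def skew_transition_def skew_scale_def algebra_simps)
    show ?thesis unfolding eqs
      by (intro conjI symmetric_two_point_moments) (use assms in simp_all)
  qed
  then show "up m * (skew_scale \<alpha> (m + 1) - b)\<^sup>2 + down m * (skew_scale \<alpha> (m - 1) - b)\<^sup>2
      \<le> (skew_scale \<alpha> m - b)\<^sup>2 + 1"
    and "up m * (skew_scale \<alpha> (m + 1) - b) ^ 4 + down m * (skew_scale \<alpha> (m - 1) - b) ^ 4
      \<le> (skew_scale \<alpha> m - b) ^ 4 + 8 * (skew_scale \<alpha> m - b)\<^sup>2 + 3" by simp_all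
qed

lemma skew_scale_inverse_lipschitz:
  assumes "0 < \<alpha>" "\<alpha> < 1"
  shows "min \<alpha> (1 - \<alpha>) * \<bar>real_of_int (a - b)\<bar> \<le> \<bar>skew_scale \<alpha> a - skew_scale \<alpha> b\<bar>"
proof -
  have *: "min \<alpha> (1 - \<alpha>) * (real_of_int a - real_of_int b) \<le> skew_scale \<alpha> a - skew_scale \<alpha> b" if "b \<le> a" for a b
  proof -
    define c where "c = min \<alpha> (1 - \<alpha>)"
    have c: "c \<le> \<alpha>" "c \<le> 1 - \<alpha>" by (simp_all add: c_def)
    consider "0 \<le> b" | "b < 0" "0 \<le> a" | "a < 0" by linarith
    then show ?thesis unfolding c_def[symmetric]
    proof cases
      case 1
      then have "c * (real_of_int a - real_of_int b) \<le> (1 - \<alpha>) * (real_of_int a - real_of_int b)"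
        using that c by (intro mult_right_mono) auto
      then show "c * (real_of_int a - real_of_int b) \<le> skew_scale \<alpha> a - skew_scale \<alpha> b"
        using 1 that by (simp add: skew_scale_def algebra_simps)
    next
      case 2
      have "c * real_of_int a \<le> (1 - \<alpha>) * real_of_int a"
        using 2 c by (intro mult_right_mono) auto
      moreover have "c * (- real_of_int b) \<le> \<alpha> * (- real_of_int b)"
        using 2 c by (intro mult_right_mono) auto
      moreover have "skew_scale \<alpha> a = (1 - \<alpha>) * real_of_int a" "skew_scale \<alpha> b = \<alpha> * real_of_int b"
        using 2 by (simp_all add: skew_scale_def)
      ultimately show "c * (real_of_int a - real_of_int b) \<le> skew_scale \<alpha> a - skew_scale \<alpha> b"
        by (simp only: right_diff_distrib mult_minus_right)
    next
      case 3
      then have "c * (real_of_int a - real_of_int b) \<le> \<alpha> * (real_of_int a - real_of_int b)"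
        using that c by (intro mult_right_mono) auto
      then show "c * (real_of_int a - real_of_int b) \<le> skew_scale \<alpha> a - skew_scale \<alpha> b"
        using 3 that by (simp add: skew_scale_def algebra_simps)
    qed
  qed
  show ?thesis
  proof (cases "b \<le> a")
    case True
    then show ?thesis using *[OF True] by simp
  next
    case False
    then show ?thesis using *[of a b] by simp
  qed
qed

section \<open>Linear interpolation\<close>

lemma linear_interp_of_nat: "linear_interp s (real k) = real_of_int (s k)"
  by (simp add: linear_interp_def)

lemma linear_interp_lipschitz:
  assumes steps: "\<And>k. \<bar>s (Suc k) - s k\<bar> \<le> 1" and uv: "0 \<le> u" "u \<le> v"
  shows "\<bar>linear_interp s v - linear_interp s u\<bar> \<le> v - u"
proof -
  obtain N where N: "v < real N" using reals_Archimedean2 by blast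
  define w where "w x k = max 0 (min 1 (x - real k))" for x k
  have diff: "linear_interp r v - linear_interp r u = (\<Sum>k<N. (w v k - w u k) * real_of_int (r (Suc k) - r k))"
    for r :: "nat \<Rightarrow> int"
    using uv N by (simp add: linear_interp_eq_sum[of _ N] w_def sum_subtractf left_diff_distrib)
  have mono: "0 \<le> w v k - w u k" for k using uv by (simp add: w_def)
  have "\<bar>linear_interp s v - linear_interp s u\<bar> \<le> (\<Sum>k<N. \<bar>(w v k - w u k) * real_of_int (s (Suc k) - s k)\<bar>)"
    unfolding diff by (rule sum_abs)
  also have "\<dots> \<le> (\<Sum>k<N. (w v k - w u k) * real_of_int (int (Suc k) - int k))"
  proof (rule sum_mono)
    fix k
    have "\<bar>real_of_int (s (Suc k) - s k)\<bar> \<le> 1" using steps[of k] by linarith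
    then show "\<bar>(w v k - w u k) * real_of_int (s (Suc k) - s k)\<bar> \<le> (w v k - w u k) * real_of_int (int (Suc k) - int k)"
      using mult_left_mono[OF _ mono[of k], of "\<bar>real_of_int (s (Suc k) - s k)\<bar>" 1] mono[of k]
      by (simp add: abs_mult)
  qed
  \<comment> \<open>The extremal walk \<open>k \<mapsto> k\<close> interpolates to the identity, which evaluates the sum of the weights.\<close>
  also have "\<dots> = linear_interp int v - linear_interp int u" by (rule diff[symmetric])
  also have "\<dots> = v - u" using uv by (simp add: linear_interp_def algebra_simps)
  finally show ?thesis .
qed

lemma power4_sum_le: "(2 + x) ^ 4 \<le> 128 + 8 * x ^ 4" for x :: real
proof -
  have "(2 + x)\<^sup>2 \<le> 8 + 2 * x\<^sup>2" using zero_le_power2[of "x - 2"] by (simp add: power2_eq_square algebra_simps)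
  then have "((2 + x)\<^sup>2)\<^sup>2 \<le> (8 + 2 * x\<^sup>2)\<^sup>2" by (intro power_mono) simp_all
  also have "\<dots> \<le> 128 + 8 * (x\<^sup>2)\<^sup>2"
    using zero_le_power2[of "x\<^sup>2 - 4"] by (simp add: power2_eq_square algebra_simps)
  finally show ?thesis by (simp flip: power_mult)
qed

lemma linear_interp_fourth_power_le:
  assumes steps: "\<And>k. \<bar>s (Suc k) - s k\<bar> \<le> 1" and uv: "0 \<le> u" "1 \<le> v - u"
  shows "(linear_interp s v - linear_interp s u) ^ 4
    \<le> 128 + 8 * (real_of_int (s (nat \<lfloor>v\<rfloor>) - s (nat \<lfloor>u\<rfloor>))) ^ 4"
proof -
  have near: "\<bar>linear_interp s x - real_of_int (s (nat \<lfloor>x\<rfloor>))\<bar> \<le> 1" if "0 \<le> x" for x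
  proof -
    have x: "real (nat \<lfloor>x\<rfloor>) \<le> x" "x - real (nat \<lfloor>x\<rfloor>) \<le> 1" using that by linarith+
    have "\<bar>linear_interp s x - linear_interp s (real (nat \<lfloor>x\<rfloor>))\<bar> \<le> x - real (nat \<lfloor>x\<rfloor>)"
      using x(1) by (intro linear_interp_lipschitz steps) simp_all
    then show ?thesis unfolding linear_interp_of_nat using x(2) by linarith
  qed
  let ?d = "real_of_int (s (nat \<lfloor>v\<rfloor>) - s (nat \<lfloor>u\<rfloor>))"
  have "\<bar>linear_interp s v - linear_interp s u\<bar> \<le> 2 + \<bar>?d\<bar>"
    using near[of u] near[of v] uv by simp
  then have "\<bar>linear_interp s v - linear_interp s u\<bar> ^ 4 \<le> (2 + \<bar>?d\<bar>) ^ 4" by (intro power_mono) simp_all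
  also have "\<dots> \<le> 128 + 8 * \<bar>?d\<bar> ^ 4" by (rule power4_sum_le)
  finally show ?thesis by (simp add: power_even_abs)
qed

section \<open>Moment bounds for the skew walk\<close>

context
  fixes \<alpha> :: real and M :: "'a measure" and S :: "nat \<Rightarrow> 'a \<Rightarrow> int"
  assumes \<alpha>: "0 < \<alpha>" "\<alpha> < 1"
    and mc: "markov_chain M S (skew_transition \<alpha>)"
begin

lemma skew_walk_prob_space: "prob_space M"
  using mc by (simp add: markov_chain_def)

lemma measurable_skew_walk [measurable]: "S k \<in> measurable M (count_space UNIV)"
  using mc by (simp add: markov_chain_def)

lemma skew_walk_unit_steps: "AE \<omega> in M. \<forall>k. \<bar>S (Suc k) \<omega> - S k \<omega>\<bar> \<le> 1"
  unfolding AE_all_countable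
proof
  fix k
  have "(\<integral>\<^sup>+\<omega>. (if \<bar>S (Suc k) \<omega> - S k \<omega>\<bar> \<le> 1 then 0 else 1) \<partial>M) =
      (\<integral>\<^sup>+\<omega>. (\<integral>\<^sup>+y. ennreal (skew_transition \<alpha> (S k \<omega>) y) * (if \<bar>y - S k \<omega>\<bar> \<le> 1 then 0 else 1) \<partial>count_space UNIV) \<partial>M)"
    using markov_chain_one_step[OF mc order_refl, of "\<lambda>a m y. if \<bar>y - m\<bar> \<le> 1 then 0 else 1" k] .
  also have "\<dots> = 0" unfolding nn_integral_skew_transition by simp
  finally have "(\<integral>\<^sup>+\<omega>. (if \<bar>S (Suc k) \<omega> - S k \<omega>\<bar> \<le> 1 then 0 else 1) \<partial>M) = 0" .
  moreover have "(\<lambda>\<omega>. if \<bar>S (Suc k) \<omega> - S k \<omega>\<bar> \<le> 1 then 0 else 1 :: ennreal) \<in> borel_measurable M"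
    by (rule measurable_compose_countable[OF _ measurable_skew_walk[of k]])
      (rule measurable_compose[OF measurable_skew_walk], simp)
  ultimately have "AE \<omega> in M. (if \<bar>S (Suc k) \<omega> - S k \<omega>\<bar> \<le> 1 then 0 else 1 :: ennreal) = 0"
    by (simp add: nn_integral_0_iff_AE)
  then show "AE \<omega> in M. \<bar>S (Suc k) \<omega> - S k \<omega>\<bar> \<le> 1"
    by (rule AE_mp) (auto split: if_splits)
qed

lemma skew_scale_second_moment:
  "(\<integral>\<^sup>+\<omega>. ennreal ((skew_scale \<alpha> (S (s + k) \<omega>) - skew_scale \<alpha> (S s \<omega>))\<^sup>2) \<partial>M) \<le> ennreal (real k)"
proof (induction k)
  case (Suc k)
  interpret prob_space M by (rule skew_walk_prob_space)
  have "(\<integral>\<^sup>+\<omega>. ennreal ((skew_scale \<alpha> (S (Suc (s + k)) \<omega>) - skew_scale \<alpha> (S s \<omega>))\<^sup>2) \<partial>M) \<le>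
      (\<integral>\<^sup>+\<omega>. ennreal ((skew_scale \<alpha> (S (s + k) \<omega>) - skew_scale \<alpha> (S s \<omega>))\<^sup>2 + 1) \<partial>M)"
    by (rule skew_walk_expectation_step[OF \<alpha> mc, where h = "\<lambda>a y. (skew_scale \<alpha> y - skew_scale \<alpha> a)\<^sup>2"])
      (use skew_transition_moments(1)[OF \<alpha>] in simp_all)
  also have "\<dots> = (\<integral>\<^sup>+\<omega>. ennreal ((skew_scale \<alpha> (S (s + k) \<omega>) - skew_scale \<alpha> (S s \<omega>))\<^sup>2) \<partial>M) + 1"
    by (simp add: nn_integral_add emeasure_space_1)
  also have "\<dots> \<le> ennreal (real k) + 1" using Suc by (intro add_right_mono)
  also have "\<dots> = ennreal (real (Suc k))"
    by (simp add: ennreal_plus[symmetric] ennreal_1[symmetric] add.commute del: ennreal_plus ennreal_1)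
  finally show ?case by simp
qed simp

text \<open>The induction closes because \<open>4 k\<^sup>2 + 8 k + 3 \<le> 4 (k + 1)\<^sup>2\<close>.\<close>

lemma skew_scale_fourth_moment:
  "(\<integral>\<^sup>+\<omega>. ennreal ((skew_scale \<alpha> (S (s + k) \<omega>) - skew_scale \<alpha> (S s \<omega>)) ^ 4) \<partial>M) \<le> ennreal (4 * (real k)\<^sup>2)"
proof (induction k)
  case (Suc k)
  interpret prob_space M by (rule skew_walk_prob_space)
  let ?D = "\<lambda>\<omega>. skew_scale \<alpha> (S (s + k) \<omega>) - skew_scale \<alpha> (S s \<omega>)"
  have "(\<integral>\<^sup>+\<omega>. ennreal ((skew_scale \<alpha> (S (Suc (s + k)) \<omega>) - skew_scale \<alpha> (S s \<omega>)) ^ 4) \<partial>M) \<le>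
      (\<integral>\<^sup>+\<omega>. ennreal (?D \<omega> ^ 4 + 8 * (?D \<omega>)\<^sup>2 + 3) \<partial>M)"
    by (rule skew_walk_expectation_step[OF \<alpha> mc, where h = "\<lambda>a y. (skew_scale \<alpha> y - skew_scale \<alpha> a) ^ 4"
          and G = "\<lambda>a m. (skew_scale \<alpha> m - skew_scale \<alpha> a) ^ 4 + 8 * (skew_scale \<alpha> m - skew_scale \<alpha> a)\<^sup>2 + 3"])
      (use skew_transition_moments(2)[OF \<alpha>] in simp_all)
  also have "\<dots> = (\<integral>\<^sup>+\<omega>. ennreal (?D \<omega> ^ 4) + 8 * ennreal ((?D \<omega>)\<^sup>2) + 3 \<partial>M)"
    by (intro nn_integral_cong) (simp add: ennreal_mult)
  also have "\<dots> = (\<integral>\<^sup>+\<omega>. ennreal (?D \<omega> ^ 4) \<partial>M) + 8 * (\<integral>\<^sup>+\<omega>. ennreal ((?D \<omega>)\<^sup>2) \<partial>M) + 3"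
    by (simp add: nn_integral_add nn_integral_cmult emeasure_space_1)
  also have "\<dots> \<le> ennreal (4 * (real k)\<^sup>2) + 8 * ennreal (real k) + 3"
    using Suc skew_scale_second_moment by (intro add_mono mult_left_mono) auto
  also have "\<dots> = ennreal (4 * (real k)\<^sup>2 + 8 * real k + 3)"
    by (simp add: ennreal_mult)
  also have "\<dots> \<le> ennreal (4 * (real (Suc k))\<^sup>2)"
    by (intro ennreal_leI) (simp add: power2_eq_square algebra_simps)
  finally show ?case by simp
qed simp

lemma skew_walk_fourth_moment:
  assumes "i \<le> j"
  shows "(\<integral>\<^sup>+\<omega>. ennreal ((real_of_int (S j \<omega> - S i \<omega>)) ^ 4) \<partial>M)
    \<le> ennreal (4 / min \<alpha> (1 - \<alpha>) ^ 4 * (real (j - i))\<^sup>2)"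
proof -
  define c where "c = min \<alpha> (1 - \<alpha>)"
  have c: "0 < c" using \<alpha> by (simp add: c_def)
  let ?D = "\<lambda>\<omega>. skew_scale \<alpha> (S (i + (j - i)) \<omega>) - skew_scale \<alpha> (S i \<omega>)"
  have "real_of_int (S j \<omega> - S i \<omega>) ^ 4 \<le> 1 / c ^ 4 * ?D \<omega> ^ 4" for \<omega>
  proof -
    have "(c * \<bar>real_of_int (S j \<omega> - S i \<omega>)\<bar>) ^ 4 \<le> \<bar>?D \<omega>\<bar> ^ 4"
      using skew_scale_inverse_lipschitz[OF \<alpha>, of "S j \<omega>" "S i \<omega>"] c assms
      by (intro power_mono) (simp_all add: c_def)
    then have "c ^ 4 * real_of_int (S j \<omega> - S i \<omega>) ^ 4 \<le> ?D \<omega> ^ 4"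
      by (simp only: power_mult_distrib power_even_abs[OF even_numeral])
    then show ?thesis using c by (simp add: field_simps)
  qed
  then have "(\<integral>\<^sup>+\<omega>. ennreal ((real_of_int (S j \<omega> - S i \<omega>)) ^ 4) \<partial>M)
      \<le> (\<integral>\<^sup>+\<omega>. ennreal (1 / c ^ 4) * ennreal (?D \<omega> ^ 4) \<partial>M)"
    using c by (intro nn_integral_mono) (simp add: ennreal_mult[symmetric] ennreal_leI)
  also have "\<dots> = ennreal (1 / c ^ 4) * (\<integral>\<^sup>+\<omega>. ennreal (?D \<omega> ^ 4) \<partial>M)"
    by (intro nn_integral_cmult) measurable
  also have "\<dots> \<le> ennreal (1 / c ^ 4) * ennreal (4 * (real (j - i))\<^sup>2)"
    by (intro mult_left_mono skew_scale_fourth_moment) simp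
  also have "\<dots> = ennreal (4 / c ^ 4 * (real (j - i))\<^sup>2)"
    using c by (simp add: ennreal_mult[symmetric])
  finally show ?thesis unfolding c_def .
qed

text \<open>Over times of length at most 1 the path is 1-Lipschitz and \<open>(v - u)\<^sup>4 \<le> (v - u)\<^sup>2\<close>. Over
  longer times, replacing the end points by their integer parts costs a constant, which is dominated
  by \<open>(v - u)\<^sup>2\<close>, and the number of steps in between is at most \<open>2 (v - u)\<close>.\<close>

lemma interpolated_fourth_moment:
  assumes uv: "0 \<le> u" "u \<le> v"
  shows "(\<integral>\<^sup>+\<omega>. ennreal ((linear_interp (\<lambda>k. S k \<omega>) v - linear_interp (\<lambda>k. S k \<omega>) u) ^ 4) \<partial>M)
    \<le> ennreal ((128 + 128 / min \<alpha> (1 - \<alpha>) ^ 4) * (v - u)\<^sup>2)"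
    (is "?I \<le> ennreal (?C * _)")
proof -
  interpret prob_space M by (rule skew_walk_prob_space)
  let ?L = "\<lambda>x \<omega>. linear_interp (\<lambda>k. S k \<omega>) x"
  define c where "c = min \<alpha> (1 - \<alpha>)"
  have c: "0 < c" using \<alpha> by (simp add: c_def)
  note steps = skew_walk_unit_steps
  show ?thesis
  proof (cases "v - u \<le> 1")
    case True
    have "AE \<omega> in M. ennreal ((?L v \<omega> - ?L u \<omega>) ^ 4) \<le> ennreal (?C * (v - u)\<^sup>2)"
      using steps
    proof (rule AE_mp, intro AE_I2 impI ennreal_leI)
      fix \<omega> assume "\<forall>k. \<bar>S (Suc k) \<omega> - S k \<omega>\<bar> \<le> 1"
      then have "\<bar>?L v \<omega> - ?L u \<omega>\<bar> \<le> v - u" using uv by (intro linear_interp_lipschitz) auto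
      then have "\<bar>?L v \<omega> - ?L u \<omega>\<bar> ^ 4 \<le> (v - u) ^ 4" by (intro power_mono) simp_all
      also have "\<dots> \<le> (v - u)\<^sup>2" using uv True by (intro power_decreasing) simp_all
      also have "\<dots> \<le> ?C * (v - u)\<^sup>2"
        using c unfolding c_def[symmetric] by (intro mult_le_cancel_right1[THEN iffD2]) (auto simp: add_increasing2)
      finally show "(?L v \<omega> - ?L u \<omega>) ^ 4 \<le> ?C * (v - u)\<^sup>2" by (simp add: power_even_abs)
    qed
    then have "?I \<le> (\<integral>\<^sup>+\<omega>. ennreal (?C * (v - u)\<^sup>2) \<partial>M)" by (rule nn_integral_mono_AE)
    then show ?thesis by (simp add: emeasure_space_1)
  next
    case False
    define i j where "i = nat \<lfloor>u\<rfloor>" and "j = nat \<lfloor>v\<rfloor>"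
    have ij: "i \<le> j" "real (j - i) \<le> 2 * (v - u)"
    proof -
      show "i \<le> j" using uv unfolding i_def j_def by (intro nat_mono floor_mono)
      have "real j \<le> v" "u < real i + 1" using uv unfolding i_def j_def by linarith+
      then show "real (j - i) \<le> 2 * (v - u)" using \<open>i \<le> j\<close> False by (simp add: of_nat_diff)
    qed
    have "AE \<omega> in M. ennreal ((?L v \<omega> - ?L u \<omega>) ^ 4) \<le> 128 + 8 * ennreal (real_of_int (S j \<omega> - S i \<omega>) ^ 4)"
      using steps
    proof (rule AE_mp, intro AE_I2 impI)
      fix \<omega> assume "\<forall>k. \<bar>S (Suc k) \<omega> - S k \<omega>\<bar> \<le> 1"
      then have "(?L v \<omega> - ?L u \<omega>) ^ 4 \<le> 128 + 8 * real_of_int (S j \<omega> - S i \<omega>) ^ 4"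
        unfolding i_def j_def using uv False by (intro linear_interp_fourth_power_le) auto
      then have "ennreal ((?L v \<omega> - ?L u \<omega>) ^ 4) \<le> ennreal (128 + 8 * real_of_int (S j \<omega> - S i \<omega>) ^ 4)"
        by (rule ennreal_leI)
      then show "ennreal ((?L v \<omega> - ?L u \<omega>) ^ 4) \<le> 128 + 8 * ennreal (real_of_int (S j \<omega> - S i \<omega>) ^ 4)"
        by (simp add: ennreal_mult)
    qed
    then have "?I \<le> (\<integral>\<^sup>+\<omega>. 128 + 8 * ennreal (real_of_int (S j \<omega> - S i \<omega>) ^ 4) \<partial>M)"
      by (rule nn_integral_mono_AE)
    also have "\<dots> = 128 + 8 * (\<integral>\<^sup>+\<omega>. ennreal (real_of_int (S j \<omega> - S i \<omega>) ^ 4) \<partial>M)"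
      by (simp add: nn_integral_add nn_integral_cmult emeasure_space_1)
    also have "\<dots> \<le> 128 + 8 * ennreal (4 / c ^ 4 * (real (j - i))\<^sup>2)"
      using skew_walk_fourth_moment[OF ij(1)] unfolding c_def by (intro add_mono mult_left_mono) auto
    also have "\<dots> = ennreal (128 + 32 / c ^ 4 * (real (j - i))\<^sup>2)"
    proof -
      have "ennreal (128 + 32 / c ^ 4 * (real (j - i))\<^sup>2) = ennreal (128 + 8 * (4 / c ^ 4 * (real (j - i))\<^sup>2))"
        by simp
      also have "\<dots> = 128 + 8 * ennreal (4 / c ^ 4 * (real (j - i))\<^sup>2)"
        using c by (subst ennreal_plus) (simp_all only: ennreal_mult', simp_all)
      finally show ?thesis ..
    qed
    also have "\<dots> \<le> ennreal (?C * (v - u)\<^sup>2)"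
    proof (rule ennreal_leI)
      have "(real (j - i))\<^sup>2 \<le> (2 * (v - u))\<^sup>2" using ij by (intro power_mono) simp_all
      then have "32 / c ^ 4 * (real (j - i))\<^sup>2 \<le> 32 / c ^ 4 * (2 * (v - u))\<^sup>2"
        using c by (intro mult_left_mono) simp_all
      moreover have "1 \<le> (v - u)\<^sup>2" using False by (simp add: one_le_power)
      moreover have "32 / c ^ 4 * (2 * (v - u))\<^sup>2 = 128 / c ^ 4 * (v - u)\<^sup>2"
        unfolding power_mult_distrib by simp
      ultimately show "128 + 32 / c ^ 4 * (real (j - i))\<^sup>2 \<le> ?C * (v - u)\<^sup>2"
        unfolding c_def[symmetric] distrib_right by linarith
    qed
    finally show ?thesis .
  qed
qed

section \<open>Tightness\<close>

lemma measurable_skew_process_apply: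
  assumes "0 \<le> t"
  shows "(\<lambda>\<omega>. cpath_apply (skew_process S n \<omega>) t) \<in> borel_measurable M"
  using measurable_skew_process[OF measurable_skew_walk]
    borel_measurable_continuous_onI[OF continuous_on_cpath_apply[OF assms]]
  by (rule measurable_compose)

text \<open>Kolmogorov's moment condition, with a constant that does not depend on \<open>n\<close>: rescaling multiplies
  the squared time increment by \<open>n\<^sup>2\<close> and divides the fourth power by \<open>(sqrt n)\<^sup>4 = n\<^sup>2\<close>.\<close>

lemma skew_process_fourth_moment:
  assumes n: "1 \<le> n" and st: "0 \<le> s" "s \<le> t"
  shows "(\<integral>\<^sup>+\<omega>. ennreal ((cpath_apply (skew_process S n \<omega>) t - cpath_apply (skew_process S n \<omega>) s) ^ 4) \<partial>M)
    \<le> ennreal ((128 + 128 / min \<alpha> (1 - \<alpha>) ^ 4) * (t - s)\<^sup>2)"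
proof -
  let ?C = "128 + 128 / min \<alpha> (1 - \<alpha>) ^ 4"
  let ?L = "\<lambda>x \<omega>. linear_interp (\<lambda>k. S k \<omega>) x"
  define q where "q = 1 / (real n)\<^sup>2"
  have q: "0 \<le> q" by (simp add: q_def)
  have meas: "?L x \<in> borel_measurable M" if "0 \<le> x" for x
  proof -
    have "(\<lambda>\<omega>. cpath_apply (skew_process S 1 \<omega>) x) = ?L x"
      using that by (simp add: fun_eq_iff skew_process_def cpath_apply_rescaled_path)
    then show ?thesis using measurable_skew_process_apply[OF that, of 1] by simp
  qed
  have "sqrt (real n) ^ 4 = (real n)\<^sup>2"
    using power_mult[of "sqrt (real n)" 2 2] by simp
  then have "(cpath_apply (skew_process S n \<omega>) t - cpath_apply (skew_process S n \<omega>) s) ^ 4 =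
      q * (?L (real n * t) \<omega> - ?L (real n * s) \<omega>) ^ 4" for \<omega>
    using st by (simp add: skew_process_def cpath_apply_rescaled_path q_def diff_divide_distrib[symmetric] power_divide)
  then have "(\<integral>\<^sup>+\<omega>. ennreal ((cpath_apply (skew_process S n \<omega>) t - cpath_apply (skew_process S n \<omega>) s) ^ 4) \<partial>M) =
      (\<integral>\<^sup>+\<omega>. ennreal q * ennreal ((?L (real n * t) \<omega> - ?L (real n * s) \<omega>) ^ 4) \<partial>M)"
    using q by (simp add: ennreal_mult)
  also have "\<dots> = ennreal q * (\<integral>\<^sup>+\<omega>. ennreal ((?L (real n * t) \<omega> - ?L (real n * s) \<omega>) ^ 4) \<partial>M)"
    using st meas[of "real n * t"] meas[of "real n * s"] by (intro nn_integral_cmult) simp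
  also have "\<dots> \<le> ennreal q * ennreal (?C * (real n * t - real n * s)\<^sup>2)"
    using st by (intro mult_left_mono interpolated_fourth_moment) (simp_all add: mult_left_mono)
  also have "\<dots> = ennreal (q * (?C * (real n * t - real n * s)\<^sup>2))"
    using q by (simp add: ennreal_mult')
  also have "q * (?C * (real n * t - real n * s)\<^sup>2) = ?C * (t - s)\<^sup>2"
    using n unfolding q_def right_diff_distrib[symmetric] power_mult_distrib by simp
  finally show ?thesis .
qed

lemma skew_process_increment_tail:
  assumes n: "1 \<le> n" and st: "0 \<le> s" "s \<le> t" and a: "0 < a"
  shows "emeasure M {\<omega> \<in> space M. a < \<bar>cpath_apply (skew_process S n \<omega>) t - cpath_apply (skew_process S n \<omega>) s\<bar>}
    \<le> ennreal ((128 + 128 / min \<alpha> (1 - \<alpha>) ^ 4) * (t - s)\<^sup>2 / a ^ 4)"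
proof -
  let ?C = "128 + 128 / min \<alpha> (1 - \<alpha>) ^ 4"
  let ?D = "\<lambda>\<omega>. cpath_apply (skew_process S n \<omega>) t - cpath_apply (skew_process S n \<omega>) s"
  have D: "?D \<in> borel_measurable M"
    using st by (intro borel_measurable_diff measurable_skew_process_apply) auto
  then have u: "(\<lambda>\<omega>. ennreal (?D \<omega> ^ 4)) \<in> borel_measurable M" by simp
  have "{\<omega> \<in> space M. a < \<bar>?D \<omega>\<bar>} \<subseteq> {\<omega> \<in> space M. 1 \<le> ennreal (1 / a ^ 4) * ennreal (?D \<omega> ^ 4)}"
  proof safe
    fix \<omega> assume "a < \<bar>?D \<omega>\<bar>"
    then have "a ^ 4 \<le> \<bar>?D \<omega>\<bar> ^ 4" using a by (intro power_mono) auto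
    then have "1 \<le> 1 / a ^ 4 * ?D \<omega> ^ 4" using a by (simp add: power_even_abs field_simps)
    then have "ennreal 1 \<le> ennreal (1 / a ^ 4 * ?D \<omega> ^ 4)" by (rule ennreal_leI)
    also have "\<dots> = ennreal (1 / a ^ 4) * ennreal (?D \<omega> ^ 4)" using a by (intro ennreal_mult') simp
    finally show "1 \<le> ennreal (1 / a ^ 4) * ennreal (?D \<omega> ^ 4)" by simp
  qed
  then have "emeasure M {\<omega> \<in> space M. a < \<bar>?D \<omega>\<bar>} \<le>
      emeasure M {\<omega> \<in> space M. 1 \<le> ennreal (1 / a ^ 4) * ennreal (?D \<omega> ^ 4)}"
    using u by (intro emeasure_mono) simp_all
  also have "\<dots> \<le> ennreal (1 / a ^ 4) * (\<integral>\<^sup>+\<omega>. ennreal (?D \<omega> ^ 4) * indicator (space M) \<omega> \<partial>M)"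
    using u by (intro nn_integral_Markov_inequality) simp_all
  also have "(\<integral>\<^sup>+\<omega>. ennreal (?D \<omega> ^ 4) * indicator (space M) \<omega> \<partial>M) = (\<integral>\<^sup>+\<omega>. ennreal (?D \<omega> ^ 4) \<partial>M)"
    by (intro nn_integral_cong) simp
  also have "ennreal (1 / a ^ 4) * \<dots> \<le> ennreal (1 / a ^ 4) * ennreal (?C * (t - s)\<^sup>2)"
    by (intro mult_left_mono skew_process_fourth_moment n st) simp
  also have "\<dots> = ennreal (?C * (t - s)\<^sup>2 / a ^ 4)"
    using a by (simp add: ennreal_mult'[symmetric])
  finally show ?thesis .
qed

text \<open>Union bound over the \<open>j 2 ^ j\<close> dyadic intervals of level \<open>j\<close>. The ratio comes from
  \<open>2 \<cdot> (1/2)\<^sup>2 / (9/10)\<^sup>4 = 5000/6561\<close>.\<close>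

lemma skew_process_level_failure:
  assumes n: "1 \<le> n"
  shows "emeasure M (\<Union>i<j * 2 ^ j. {\<omega> \<in> space M.
      (9/10) ^ j < \<bar>cpath_apply (skew_process S n \<omega>) (real (i + 1) / 2 ^ j) - cpath_apply (skew_process S n \<omega>) (real i / 2 ^ j)\<bar>})
    \<le> ennreal ((128 + 128 / min \<alpha> (1 - \<alpha>) ^ 4) * (real j * (5000/6561) ^ j))"
    (is "emeasure M (\<Union>i<_. ?A i) \<le> ennreal (?C * _)")
proof -
  have A: "?A i \<in> sets M" for i
  proof -
    have "(\<lambda>\<omega>. cpath_apply (skew_process S n \<omega>) (real (i + 1) / 2 ^ j) - cpath_apply (skew_process S n \<omega>) (real i / 2 ^ j))
        \<in> borel_measurable M"
      by (intro borel_measurable_diff measurable_skew_process_apply) auto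
    then show ?thesis by measurable
  qed
  have "emeasure M (?A i) \<le> ennreal (?C * (1 / 2 ^ j)\<^sup>2 / ((9/10) ^ j) ^ 4)" for i
    using skew_process_increment_tail[OF n, of "real i / 2 ^ j" "real (i + 1) / 2 ^ j" "(9/10) ^ j"]
    by (simp add: divide_right_mono diff_divide_distrib[symmetric])
  then have "(\<Sum>i<j * 2 ^ j. emeasure M (?A i)) \<le> (\<Sum>i<j * 2 ^ j. ennreal (?C * (1 / 2 ^ j)\<^sup>2 / ((9/10) ^ j) ^ 4))"
    by (intro sum_mono)
  also have "\<dots> = ennreal (real (j * 2 ^ j) * (?C * (1 / 2 ^ j)\<^sup>2 / ((9/10) ^ j) ^ 4))"
    by (subst ennreal_mult') (simp_all add: ennreal_of_nat_eq_real_of_nat)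
  also have "real (j * 2 ^ j) * (?C * (1 / 2 ^ j)\<^sup>2 / ((9/10) ^ j) ^ 4) = ?C * (real j * (5000/6561) ^ j)"
  proof -
    have "real (j * 2 ^ j) * (?C * (1 / 2 ^ j)\<^sup>2 / ((9/10) ^ j) ^ 4) =
        ?C * (real j * (2 ^ j * ((1 / 2 ^ j)\<^sup>2 / ((9/10) ^ j) ^ 4)))"
      by simp
    also have "2 ^ j * ((1 / 2 ^ j)\<^sup>2 / ((9/10) ^ j) ^ 4) = (2 * ((1/2)\<^sup>2 / (9/10) ^ 4) :: real) ^ j"
    proof -
      have "(1 / 2 ^ j)\<^sup>2 = ((1/2)\<^sup>2 :: real) ^ j" "((9/10) ^ j) ^ 4 = ((9/10) ^ 4 :: real) ^ j"
        by (simp_all only: power_one_over[symmetric] power_mult[symmetric] mult.commute)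
      then show ?thesis by (simp only: power_mult_distrib power_divide[of "(1/2)\<^sup>2" "(9/10) ^ 4"])
    qed
    also have "(2 * ((1/2)\<^sup>2 / (9/10) ^ 4) :: real) = 5000/6561" by (simp add: power_divide)
    finally show ?thesis .
  qed
  finally show ?thesis
    using emeasure_subadditive_finite[of "{..<j * 2 ^ j}" ?A M] A by (auto intro: order_trans)
qed

end

lemma summable_dyadic_failure_bounds: "summable (\<lambda>j. C * (real j * (5000/6561) ^ j))" for C :: real
proof (rule summable_mult)
  have "summable (\<lambda>j. real (Suc j) * (5000/6561 :: real) ^ j)"
    using geometric_deriv_sums[of "5000/6561 :: real"] by (simp add: sums_iff)
  then show "summable (\<lambda>j. real j * (5000/6561) ^ j)"
    by (rule summable_comparison_test'[where N = 0]) (simp add: mult_right_mono)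
qed

theorem corollary1p2:
  fixes \<alpha> :: real and M :: "'a measure" and S :: "nat \<Rightarrow> 'a \<Rightarrow> int"
  assumes "0 < \<alpha>" and "\<alpha> < 1"
    and "skew_random_walk \<alpha> M S"
  shows "tight_family ((\<lambda>n. distr M borel (skew_process S n)) ` {1..})"
proof -
  have mc: "markov_chain M S (skew_transition \<alpha>)" and zero: "AE \<omega> in M. S 0 \<omega> = 0"
    using assms(3) by (simp_all add: skew_random_walk_def)
  interpret prob_space M by (rule skew_walk_prob_space[OF assms(1,2) mc])
  have X[measurable]: "skew_process S n \<in> measurable M borel" for n
    by (rule measurable_skew_process[OF measurable_skew_walk[OF assms(1,2) mc]])
  define c where "c j = (128 + 128 / min \<alpha> (1 - \<alpha>) ^ 4) * (real j * (5000/6561) ^ j)" for j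
  have c: "summable c" "\<And>j. 0 \<le> c j"
    unfolding c_def using summable_dyadic_failure_bounds assms(1,2) by (auto intro: add_nonneg_nonneg)
  have K_exists: "\<exists>K. compact K \<and> (\<forall>n\<ge>1. measure (distr M borel (skew_process S n)) K \<ge> 1 - \<epsilon>)" if "0 < \<epsilon>" for \<epsilon>
  proof -
    obtain J where J: "norm (\<Sum>j. c (j + J)) < \<epsilon>"
      using suminf_exist_split[OF \<open>0 < \<epsilon>\<close> c(1)] by blast
    let ?K = "dyadic_holder_paths J"
    have K: "?K \<in> sets borel" using closed_dyadic_holder_paths by (rule borel_closed)
    have "1 - \<epsilon> \<le> measure (distr M borel (skew_process S n)) ?K" if n: "1 \<le> n" for n
    proof -
      define A where "A j = (\<Union>i<j * 2 ^ j. {\<omega> \<in> space M. (9/10) ^ j <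
        \<bar>cpath_apply (skew_process S n \<omega>) (real (i + 1) / 2 ^ j) - cpath_apply (skew_process S n \<omega>) (real i / 2 ^ j)\<bar>})" for j
      have A: "A j \<in> sets M" for j
      proof -
        have "(\<lambda>\<omega>. cpath_apply (skew_process S n \<omega>) (real (i + 1) / 2 ^ j) - cpath_apply (skew_process S n \<omega>) (real i / 2 ^ j))
            \<in> borel_measurable M" for i
          by (intro borel_measurable_diff measurable_skew_process_apply[OF assms(1,2) mc]) auto
        then show ?thesis unfolding A_def by measurable
      qed
      let ?bad = "{\<omega> \<in> space M. skew_process S n \<omega> \<in> - ?K}"
      have bad_sets: "?bad \<in> sets M"
        using measurable_sets[OF X[of n], of "- ?K"] K by (simp add: vimage_def Int_def conj_commute)
      have "emeasure M ?bad \<le> emeasure M (\<Union>j. A (j + J))"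
      proof (rule emeasure_mono_AE)
        show "AE \<omega> in M. \<omega> \<in> ?bad \<longrightarrow> \<omega> \<in> (\<Union>j. A (j + J))"
          using zero
        proof (rule AE_mp, intro AE_I2 impI)
          fix \<omega> assume "\<omega> \<in> space M" "S 0 \<omega> = 0" "\<omega> \<in> ?bad"
          moreover have "cpath_apply (skew_process S n \<omega>) 0 = 0"
            using \<open>S 0 \<omega> = 0\<close> linear_interp_of_nat[of "\<lambda>k. S k \<omega>" 0]
            by (simp add: skew_process_def cpath_apply_rescaled_path)
          ultimately show "\<omega> \<in> (\<Union>j. A (j + J))"
            unfolding compl_dyadic_holder_paths A_def by blast
        qed
      qed (use A in blast)
      also have "\<dots> \<le> (\<Sum>j. emeasure M (A (j + J)))"
        using A by (intro emeasure_subadditive_countably) blast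
      also have "\<dots> \<le> (\<Sum>j. ennreal (c (j + J)))"
        unfolding A_def c_def
        by (intro suminf_le skew_process_level_failure[OF assms(1,2) mc n] summableI)
      also have "\<dots> = ennreal (\<Sum>j. c (j + J))"
        using c by (intro suminf_ennreal2) (simp_all add: summable_ignore_initial_segment)
      also have "\<dots> \<le> ennreal \<epsilon>" using J by (intro ennreal_leI) simp
      finally have "prob ?bad \<le> \<epsilon>" using that \<open>0 < \<epsilon>\<close> by (simp add: emeasure_eq_measure)
      moreover have "prob ?bad = 1 - prob {\<omega> \<in> space M. skew_process S n \<omega> \<in> ?K}"
      proof -
        have "{\<omega> \<in> space M. skew_process S n \<omega> \<in> ?K} = space M - ?bad" by auto
        then show ?thesis using prob_compl[OF bad_sets] by simp
      qed
      moreover have "measure (distr M borel (skew_process S n)) ?K = prob {\<omega> \<in> space M. skew_process S n \<omega> \<in> ?K}"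
        using K by (subst measure_distr) (simp_all add: vimage_def Int_def conj_commute)
      ultimately show ?thesis by simp
    qed
    then show ?thesis using compact_dyadic_holder_paths by blast
  qed
  show ?thesis
    unfolding tight_family_def
  proof (intro conjI ballI allI impI)
    show "prob_space \<mu>" "sets \<mu> = sets borel"
      if "\<mu> \<in> (\<lambda>n. distr M borel (skew_process S n)) ` {1..}" for \<mu>
      using that prob_space_distr[OF X] by (elim imageE, simp)+
    show "\<exists>K. compact K \<and> (\<forall>\<mu>\<in>(\<lambda>n. distr M borel (skew_process S n)) ` {1..}. 1 - \<epsilon> \<le> measure \<mu> K)"
      if "0 < \<epsilon>" for \<epsilon>
    proof -
      obtain K where K: "compact K"
        "\<forall>n\<ge>1. 1 - \<epsilon> \<le> measure (distr M borel (skew_process S n)) K"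
        using K_exists[OF \<open>0 < \<epsilon>\<close>] by (elim exE conjE)
      show ?thesis
      proof (intro exI[of _ K] conjI ballI)
        show "compact K" by (rule K(1))
        show "1 - \<epsilon> \<le> measure \<mu> K" if "\<mu> \<in> (\<lambda>n. distr M borel (skew_process S n)) ` {1..}" for \<mu>
          using that K(2) by (elim imageE) simp
      qed
    qed
  qed
qed

end
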